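(* Let $\{f_\theta:\theta\in\Theta\}$ be a parametric family of densities on a space $\mathcal{X}$, each with respect to a common base measure $\nu_{\mathcal{X}}$, and let $\pi$ be a positive prior density on $\Theta$ with respect to a base measure $\nu_\Theta$. Suppose that for every $\theta\in\Theta$ the support of $f_\theta$ is contained in the support of $\bar f_\pi$. Fix integers $B\ge 1$ and $M\ge 1$. Suppose $X\sim f_{\theta_0}$ for some $\theta_0\in\Theta$, and, given $X$, draw $\widehat\theta_1,\dots,\widehat\theta_B$ i.i.d. from the posterior $\pi(\cdot\mid X)$; then, given $(X,\widehat\theta_{1:B})$, draw $\widetilde X^{(1)},\dots,\widetilde X^{(M)}$ i.i.d. from the density $g_\pi(\cdot\mid\widehat\theta_{1:B})$. Then $$\mathrm{d}_{\mathrm{exch}}\big(X,\widetilde X^{(1)},\dots,\widetilde X^{(M)}\big)\le \inf_{\pi_0}\Big\{\epsilon(\pi_0)+\frac{\Delta(\pi_0)}{2\sqrt B}\Big\},$$ where the infimum is over all densities $\pi_0$ on $\Theta$ with respect to $\nu_\Theta$ such that the support of $\bar f_{\pi_0}$ contains the support of $f_\theta$ for every $\theta\in\Theta$.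
   Context: For a prior density $\rho$ on $\Theta$ (w.r.t. $\nu_\Theta$), the marginal likelihood is $\bar f_\rho(x)=\int_\Theta \rho(\theta)f_\theta(x)\,d\nu_\Theta(\theta)$ and the posterior density (w.r.t. $\nu_\Theta$) is $\rho(\theta\mid x)=\rho(\theta)f_\theta(x)/\bar f_\rho(x)$. For $\theta_1,\dots,\theta_B\in\Theta$, $g_\pi(\cdot\mid\theta_{1:B})$ is the probability density on $\mathcal{X}$ (w.r.t. $\nu_{\mathcal X}$) proportional to $x\mapsto \prod_{b=1}^B f_{\theta_b}(x)/\bar f_\pi(x)^{B-1}$. For a prior density $\pi_0$: $\epsilon(\pi_0)=\mathrm{d}_{\mathrm{TV}}(f_{\theta_0},\bar f_{\pi_0})$ (total variation distance between the distributions with these densities), and $\Delta(\pi_0)=\mathbb{E}_{X\sim f_{\theta_0}}\big[\mathrm{d}_{\chi^2}(\pi_0(\cdot\mid X)\,\|\,\pi(\cdot\mid X))^{1/2}\big]$, where $\mathrm{d}_{\chi^2}(Q\|P)=\int (dQ/dP-1)^2\,dP$ is the $\chi^2$ divergence. For a random vector $(Z_0,\dots,Z_M)$, the distance to exchangeability $\mathrm{d}_{\mathrm{exch}}(Z_0,\dots,Z_M)$ is the infimum of $\mathrm{d}_{\mathrm{TV}}$ between the law of $(Z_0,\dots,Z_M)$ and the law of any exchangeable random vector $(Z_0',\dots,Z_M')$. *)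

theory Defs
  imports "HOL-Probability.Probability" "HOL-Combinatorics.Permutations"
begin

definition margE :: "'t measure \<Rightarrow> ('t \<Rightarrow> 'x \<Rightarrow> real) \<Rightarrow> ('t \<Rightarrow> real) \<Rightarrow> 'x \<Rightarrow> ennreal" where
  "margE MT f \<rho> x = (\<integral>\<^sup>+ \<theta>. ennreal (\<rho> \<theta> * f \<theta> x) \<partial>MT)"

definition marg :: "'t measure \<Rightarrow> ('t \<Rightarrow> 'x \<Rightarrow> real) \<Rightarrow> ('t \<Rightarrow> real) \<Rightarrow> 'x \<Rightarrow> real" where
  "marg MT f \<rho> x = enn2real (margE MT f \<rho> x)"

definition post :: "'t measure \<Rightarrow> ('t \<Rightarrow> 'x \<Rightarrow> real) \<Rightarrow> ('t \<Rightarrow> real) \<Rightarrow> 'x \<Rightarrow> 't \<Rightarrow> real" where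
  "post MT f \<rho> x \<theta> = \<rho> \<theta> * f \<theta> x / marg MT f \<rho> x"

definition g_un :: "'t measure \<Rightarrow> ('t \<Rightarrow> 'x \<Rightarrow> real) \<Rightarrow> ('t \<Rightarrow> real) \<Rightarrow> nat \<Rightarrow> (nat \<Rightarrow> 't) \<Rightarrow> 'x \<Rightarrow> real" where
  "g_un MT f \<pi> B th x = (\<Prod>b<B. f (th b) x) / marg MT f \<pi> x ^ (B - 1)"

definition g_norm :: "'x measure \<Rightarrow> 't measure \<Rightarrow> ('t \<Rightarrow> 'x \<Rightarrow> real) \<Rightarrow> ('t \<Rightarrow> real) \<Rightarrow> nat \<Rightarrow> (nat \<Rightarrow> 't) \<Rightarrow> ennreal" where
  "g_norm MX MT f \<pi> B th = (\<integral>\<^sup>+ y. ennreal (g_un MT f \<pi> B th y) \<partial>MX)"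

definition g_dens :: "'x measure \<Rightarrow> 't measure \<Rightarrow> ('t \<Rightarrow> 'x \<Rightarrow> real) \<Rightarrow> ('t \<Rightarrow> real) \<Rightarrow> nat \<Rightarrow> (nat \<Rightarrow> 't) \<Rightarrow> 'x \<Rightarrow> real" where
  "g_dens MX MT f \<pi> B th x = g_un MT f \<pi> B th x / enn2real (g_norm MX MT f \<pi> B th)"

text \<open>Joint law of (X, Xtilde^(1), ..., Xtilde^(M)) as a measure on X^{0..M}:
  X ~ f_{theta0}, theta_hat_{1:B} iid from pi(.|X), Xtilde^(m) iid from g_pi(.|theta_hat_{1:B}).
  Its density w.r.t. the product base measure is obtained by integrating out theta_hat.\<close>
definition joint_law :: "'x measure \<Rightarrow> 't measure \<Rightarrow> ('t \<Rightarrow> 'x \<Rightarrow> real) \<Rightarrow> ('t \<Rightarrow> real) \<Rightarrow> 't \<Rightarrow> nat \<Rightarrow> nat \<Rightarrow> (nat \<Rightarrow> 'x) measure" where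
  "joint_law MX MT f \<pi> \<theta>0 B M =
     density (PiM {..M} (\<lambda>_. MX))
       (\<lambda>z. ennreal (f \<theta>0 (z 0)) *
            (\<integral>\<^sup>+ th. ennreal ((\<Prod>b<B. post MT f \<pi> (z 0) (th b)) *
                                (\<Prod>m\<in>{1..M}. g_dens MX MT f \<pi> B th (z m)))
              \<partial>(PiM {..<B} (\<lambda>_. MT))))"

definition tv_dist :: "'a measure \<Rightarrow> 'a measure \<Rightarrow> real" where
  "tv_dist P Q = (SUP A \<in> sets P. \<bar>measure P A - measure Q A\<bar>)"

definition exchangeable_law :: "'x measure \<Rightarrow> nat \<Rightarrow> (nat \<Rightarrow> 'x) measure \<Rightarrow> bool" where
  "exchangeable_law MX M Q \<longleftrightarrow>
     prob_space Q \<and> sets Q = sets (PiM {..M} (\<lambda>_. MX)) \<and>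
     (\<forall>\<sigma>. \<sigma> permutes {..M} \<longrightarrow>
        distr Q (PiM {..M} (\<lambda>_. MX)) (\<lambda>z. restrict (z \<circ> \<sigma>) {..M}) = Q)"

definition d_exch :: "'x measure \<Rightarrow> nat \<Rightarrow> (nat \<Rightarrow> 'x) measure \<Rightarrow> real" where
  "d_exch MX M P = (INF Q \<in> {Q. exchangeable_law MX M Q}. tv_dist P Q)"

definition sqrt_enn :: "ennreal \<Rightarrow> ennreal" where
  "sqrt_enn c = (if c = \<infinity> then \<infinity> else ennreal (sqrt (enn2real c)))"

definition chi2 :: "'t measure \<Rightarrow> ('t \<Rightarrow> real) \<Rightarrow> ('t \<Rightarrow> real) \<Rightarrow> ennreal" where
  "chi2 MT q p = (\<integral>\<^sup>+ \<theta>. ennreal ((q \<theta> / p \<theta> - 1)^2 * p \<theta>) \<partial>MT)"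

definition eps_err :: "'x measure \<Rightarrow> 't measure \<Rightarrow> ('t \<Rightarrow> 'x \<Rightarrow> real) \<Rightarrow> 't \<Rightarrow> ('t \<Rightarrow> real) \<Rightarrow> real" where
  "eps_err MX MT f \<theta>0 \<pi>0 =
     tv_dist (density MX (\<lambda>x. ennreal (f \<theta>0 x))) (density MX (margE MT f \<pi>0))"

definition Delta_err :: "'x measure \<Rightarrow> 't measure \<Rightarrow> ('t \<Rightarrow> 'x \<Rightarrow> real) \<Rightarrow> ('t \<Rightarrow> real) \<Rightarrow> 't \<Rightarrow> ('t \<Rightarrow> real) \<Rightarrow> ennreal" where
  "Delta_err MX MT f \<pi> \<theta>0 \<pi>0 =
     (\<integral>\<^sup>+ x. ennreal (f \<theta>0 x) * sqrt_enn (chi2 MT (post MT f \<pi>0 x) (post MT f \<pi> x)) \<partial>MX)"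

definition admissible_prior :: "'x measure \<Rightarrow> 't measure \<Rightarrow> ('t \<Rightarrow> 'x \<Rightarrow> real) \<Rightarrow> ('t \<Rightarrow> real) \<Rightarrow> bool" where
  "admissible_prior MX MT f \<pi>0 \<longleftrightarrow>
     \<pi>0 \<in> borel_measurable MT \<and> (\<forall>\<theta>\<in>space MT. 0 \<le> \<pi>0 \<theta>) \<and>
     (\<integral>\<^sup>+ \<theta>. ennreal (\<pi>0 \<theta>) \<partial>MT) = 1 \<and>
     (\<forall>\<theta>\<in>space MT. \<forall>x\<in>space MX. 0 < f \<theta> x \<longrightarrow> 0 < margE MT f \<pi>0 x)"

end

theory Submission
  imports Defs
begin

text \<open>
  Write \<open>F\<close> and \<open>H\<close> for the marginal likelihoods of \<open>\<pi>\<close> and \<open>\<pi>0\<close>. Reweight the \<open>B\<close> parameters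
  by the average \<open>R\<close> of the ratios \<open>\<pi>0 (\<theta>\<^sub>b) / \<pi> (\<theta>\<^sub>b)\<close>: if \<open>(\<theta>, x)\<close> has density
  \<open>(\<Prod>b. \<pi> (\<theta>\<^sub>b)) * R \<theta> * (\<Prod>b. f \<theta>\<^sub>b x) / F x ^ (B - 1)\<close>, then \<open>x\<close> has density \<open>H\<close>, and the
  conditional law of \<open>x\<close> given \<open>\<theta>\<close> is \<open>g\<^sub>\<pi>\<close>. Drawing all \<open>M + 1\<close> observations i.i.d. from \<open>g\<^sub>\<pi>\<close>
  given such a \<open>\<theta>\<close> is therefore exchangeable. It differs from the actual joint law in two respects.
  The first observation has density \<open>H\<close> instead of \<open>f \<theta>0\<close>, which costs \<open>\<epsilon> (\<pi>0)\<close>. Given \<open>x\<close>, the density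
  of \<open>\<theta>\<close> relative to the product of the \<open>\<pi>\<close>-posteriors is not \<open>1\<close> but the average of \<open>B\<close> i.i.d.
  posterior ratios of mean \<open>1\<close>. Its variance is the chi-square divergence divided by \<open>B\<close>, so by
  Cauchy-Schwarz this costs at most half the square root of that variance.
\<close>

section \<open>Averages of i.i.d. likelihood ratios\<close>

text \<open>Expanding the square leaves the diagonal terms, each with the second moment of
  \<open>h\<close>, and the cross terms, whose integrals vanish by independence and
  \<open>h0\<close>.\<close>

lemma (in prob_space) integral_PiM_square_sum:
  fixes h :: "'a \<Rightarrow> real"
  assumes I: "finite I" and h[measurable]: "h \<in> borel_measurable M"
    and h2: "integrable M (\<lambda>x. (h x)\<^sup>2)" and h0: "expectation h = 0"
  shows "integrable (PiM I (\<lambda>_. M)) (\<lambda>\<omega>. (\<Sum>i\<in>I. h (\<omega> i))\<^sup>2)"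
    and "(\<integral>\<omega>. (\<Sum>i\<in>I. h (\<omega> i))\<^sup>2 \<partial>PiM I (\<lambda>_. M)) = card I * expectation (\<lambda>x. (h x)\<^sup>2)"
proof -
  interpret P: product_prob_space "\<lambda>_. M" I by standard
  have h1: "integrable M h"
    using square_integrable_imp_integrable[OF h h2] .
  have cross: "integrable (PiM I (\<lambda>_. M)) (\<lambda>\<omega>. h (\<omega> i) * h (\<omega> j)) \<and>
      (\<integral>\<omega>. h (\<omega> i) * h (\<omega> j) \<partial>PiM I (\<lambda>_. M)) = (if i = j then expectation (\<lambda>x. (h x)\<^sup>2) else 0)"
    if ij: "i \<in> I" "j \<in> I" for i j
  proof (cases "i = j")
    case True
    have d: "distr (PiM I (\<lambda>_. M)) M (\<lambda>\<omega>. \<omega> i) = M"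
      using P.PiM_component[OF ij(1)] .
    have [measurable]: "(\<lambda>\<omega>. \<omega> i) \<in> measurable (PiM I (\<lambda>_. M)) M"
      using ij(1) by (rule measurable_component_singleton)
    have "integrable (PiM I (\<lambda>_. M)) (\<lambda>\<omega>. (h (\<omega> i))\<^sup>2)"
      using integrable_distr_eq[of "\<lambda>\<omega>. \<omega> i" "PiM I (\<lambda>_. M)" M "\<lambda>x. (h x)\<^sup>2"] h2
      unfolding d by simp
    moreover have "(\<integral>\<omega>. (h (\<omega> i))\<^sup>2 \<partial>PiM I (\<lambda>_. M)) = expectation (\<lambda>x. (h x)\<^sup>2)"
      using integral_distr[of "\<lambda>\<omega>. \<omega> i" "PiM I (\<lambda>_. M)" M "\<lambda>x. (h x)\<^sup>2"]
      unfolding d by simp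
    ultimately show ?thesis using True by (simp add: power2_eq_square)
  next
    case False
    \<comment> \<open>The factor \<open>h\<close> at the two indices \<open>i\<close> and
      \<open>j\<close> and 1 elsewhere: this puts the product of two coordinates into the shape of
      the formula for integrals of full products.\<close>
    let ?e = "\<lambda>k. if k = i \<or> k = j then h else (\<lambda>_. 1)"
    have e: "integrable M (?e k)" for k using h1 by simp
    have p: "(\<Prod>k\<in>I. ?e k (\<omega> k)) = h (\<omega> i) * h (\<omega> j)" for \<omega>
    proof -
      have "(\<Prod>k\<in>I. ?e k (\<omega> k)) = (\<Prod>k\<in>{i,j}. ?e k (\<omega> k))"
        using ij I by (intro prod.mono_neutral_right) auto
      then show ?thesis using False by simp
    qed
    have "(\<Prod>k\<in>I. integral\<^sup>L M (?e k)) = 0"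
      using ij I h0 by (auto intro!: prod_zero bexI[of _ i])
    then show ?thesis
      using P.product_integral_prod[of I ?e, OF I e] P.product_integrable_prod[of I ?e, OF I e] False
      unfolding p by simp
  qed
  have sq: "(\<Sum>i\<in>I. h (\<omega> i))\<^sup>2 = (\<Sum>i\<in>I. \<Sum>j\<in>I. h (\<omega> i) * h (\<omega> j))" for \<omega>
    by (simp add: power2_eq_square sum_product)
  show "integrable (PiM I (\<lambda>_. M)) (\<lambda>\<omega>. (\<Sum>i\<in>I. h (\<omega> i))\<^sup>2)"
    unfolding sq using cross by auto
  show "(\<integral>\<omega>. (\<Sum>i\<in>I. h (\<omega> i))\<^sup>2 \<partial>PiM I (\<lambda>_. M)) = card I * expectation (\<lambda>x. (h x)\<^sup>2)"
    unfolding sq using cross I by (subst Bochner_Integration.integral_sum) (auto simp: sum.delta)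
qed

text \<open>This is the nonnegativity of the variance of |Y|.\<close>

lemma (in prob_space) expectation_abs_le_sqrt:
  fixes Y :: "'a \<Rightarrow> real"
  assumes Y: "Y \<in> borel_measurable M" "integrable M (\<lambda>x. (Y x)\<^sup>2)"
  shows "expectation (\<lambda>x. \<bar>Y x\<bar>) \<le> sqrt (expectation (\<lambda>x. (Y x)\<^sup>2))"
proof -
  have "integrable M Y" using square_integrable_imp_integrable[OF Y] .
  then have "variance (\<lambda>x. \<bar>Y x\<bar>) = expectation (\<lambda>x. (Y x)\<^sup>2) - (expectation (\<lambda>x. \<bar>Y x\<bar>))\<^sup>2"
    using Y by (subst variance_eq) auto
  then show ?thesis
    using variance_positive[of "\<lambda>x. \<bar>Y x\<bar>"] by (intro real_le_rsqrt) simp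
qed

text \<open>Since \<open>1 - R\<close> has mean zero, \<open>u\<close> may be recentred to \<open>u - 1/2\<close>, of modulus at most
  \<open>1/2\<close>.\<close>
lemma (in prob_space) expectation_change_of_measure_le:
  fixes u R :: "'a \<Rightarrow> real"
  assumes [measurable]: "u \<in> borel_measurable M" "R \<in> borel_measurable M"
    and u: "\<And>x. x \<in> space M \<Longrightarrow> 0 \<le> u x \<and> u x \<le> 1"
    and R2: "integrable M (\<lambda>x. (R x - 1)\<^sup>2)" and R1: "expectation R = 1"
  shows "integrable M (\<lambda>x. R x * u x)"
    and "expectation u \<le> expectation (\<lambda>x. R x * u x) + sqrt (expectation (\<lambda>x. (R x - 1)\<^sup>2)) / 2"
proof -
  have iR1: "integrable M (\<lambda>x. R x - 1)" by (rule square_integrable_imp_integrable[OF _ R2]) simp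
  then have iR: "integrable M R" using Bochner_Integration.integrable_add[OF iR1, of "\<lambda>_. 1"] by simp
  have iu: "integrable M u" by (rule integrable_const_bound[of _ 1]) (use u in auto)
  show iRu: "integrable M (\<lambda>x. R x * u x)"
    by (rule Bochner_Integration.integrable_bound[OF iR])
       (use u in \<open>auto simp: abs_mult intro!: mult_left_le\<close>)
  have "expectation u - expectation (\<lambda>x. R x * u x) = expectation (\<lambda>x. (u x - 1/2) * (1 - R x))"
  proof -
    have "expectation (\<lambda>x. (u x - 1/2) * (1 - R x)) = expectation (\<lambda>x. u x - R x * u x - 1/2 + R x / 2)"
      by (simp add: field_simps)
    also have "\<dots> = expectation u - expectation (\<lambda>x. R x * u x)"
      using iu iRu iR R1 by (simp add: prob_space)
    finally show ?thesis by simp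
  qed
  also have "\<dots> \<le> expectation (\<lambda>x. \<bar>R x - 1\<bar> / 2)"
  proof (rule integral_mono_AE')
    show "AE x in M. (u x - 1/2) * (1 - R x) \<le> \<bar>R x - 1\<bar> / 2"
    proof (rule AE_I2)
      fix x assume "x \<in> space M"
      then have "\<bar>u x - 1/2\<bar> \<le> 1/2" using u[of x] unfolding abs_le_iff by simp
      then have "\<bar>u x - 1/2\<bar> * \<bar>1 - R x\<bar> \<le> 1/2 * \<bar>1 - R x\<bar>" by (intro mult_right_mono) auto
      then show "(u x - 1/2) * (1 - R x) \<le> \<bar>R x - 1\<bar> / 2"
        using abs_ge_self[of "(u x - 1/2) * (1 - R x)"] by (simp add: abs_mult abs_minus_commute)
    qed
  qed (use iR1 in auto)
  also have "\<dots> \<le> sqrt (expectation (\<lambda>x. (R x - 1)\<^sup>2)) / 2"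
    using expectation_abs_le_sqrt[OF _ R2] by simp
  finally show "expectation u \<le> expectation (\<lambda>x. R x * u x) + sqrt (expectation (\<lambda>x. (R x - 1)\<^sup>2)) / 2"
    by simp
qed

text \<open>Change of measure with the average of \<open>B\<close> i.i.d. copies of
  \<open>r\<close>. Averaging divides the variance by \<open>B\<close>, which produces the factor
  sqrt B; the 2 comes from the recentring of \<open>u\<close>. Working in \<open>ennreal\<close>
  keeps the case of infinite variance. In the application \<open>M\<close> is the posterior,
  \<open>r\<close> the ratio of two posteriors, and \<open>u\<close> the conditional probability of
  an event given the parameters.\<close>

lemma (in prob_space) nn_integral_PiM_average_le:
  fixes r :: "'a \<Rightarrow> real" and u :: "(nat \<Rightarrow> 'a) \<Rightarrow> ennreal"
  assumes r[measurable]: "r \<in> borel_measurable M" and r0: "\<And>x. x \<in> space M \<Longrightarrow> 0 \<le> r x"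
    and r1: "(\<integral>\<^sup>+x. ennreal (r x) \<partial>M) = 1"
    and B: "1 \<le> B" and u[measurable]: "u \<in> borel_measurable (PiM {..<B} (\<lambda>_. M))"
    and u1: "\<And>\<omega>. \<omega> \<in> space (PiM {..<B} (\<lambda>_. M)) \<Longrightarrow> u \<omega> \<le> 1"
  shows "(\<integral>\<^sup>+\<omega>. u \<omega> \<partial>PiM {..<B} (\<lambda>_. M)) \<le>
     (\<integral>\<^sup>+\<omega>. ennreal ((\<Sum>b<B. r (\<omega> b)) / B) * u \<omega> \<partial>PiM {..<B} (\<lambda>_. M))
       + sqrt_enn (\<integral>\<^sup>+x. ennreal ((r x - 1)\<^sup>2) \<partial>M) / ennreal (2 * sqrt B)" (is "_ \<le> ?I + _")
proof (cases "(\<integral>\<^sup>+x. ennreal ((r x - 1)\<^sup>2) \<partial>M) = \<infinity>")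
  case True
  then show ?thesis by (simp add: sqrt_enn_def ennreal_top_divide)
next
  case False
  interpret P: product_prob_space "\<lambda>_. M" "{..<B}" by standard
  let ?N = "PiM {..<B} (\<lambda>_. M)"
  define R where "R \<omega> = (\<Sum>b<B. r (\<omega> b)) / B" for \<omega>
  have [measurable]: "R \<in> borel_measurable ?N" unfolding R_def by measurable
  have R0: "0 \<le> R \<omega>" if "\<omega> \<in> space ?N" for \<omega>
    using that r0 unfolding R_def by (auto intro!: divide_nonneg_nonneg sum_nonneg simp: space_PiM)
  have h2: "integrable M (\<lambda>x. (r x - 1)\<^sup>2)"
    using False by (intro integrableI_nonneg) (auto simp: less_top)
  have h1: "integrable M (\<lambda>x. r x - 1)" by (rule square_integrable_imp_integrable[OF _ h2]) simp
  then have ir: "integrable M r" using Bochner_Integration.integrable_add[OF h1, of "\<lambda>_. 1"] by simp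
  have er: "expectation r = 1"
    using r1 r0 by (subst integral_eq_nn_integral) auto
  have h0: "expectation (\<lambda>x. r x - 1) = 0" using ir er by (simp add: prob_space)
  note S = integral_PiM_square_sum[OF finite_lessThan[of B] _ h2 h0]
  \<comment> \<open>Centring inside the average turns \<open>R - 1\<close> into a sum of i.i.d.
    mean-zero terms divided by \<open>B\<close>; the square of that divisor against the
    \<open>B\<close> diagonal terms leaves 1/B.\<close>
  have R1: "R \<omega> - 1 = (\<Sum>b<B. r (\<omega> b) - 1) / B" for \<omega>
    using B by (simp add: R_def sum_subtractf field_simps)
  have R2: "integrable ?N (\<lambda>\<omega>. (R \<omega> - 1)\<^sup>2)"
    unfolding R1 power_divide using S(1) by simp
  have E2: "P.expectation (\<lambda>\<omega>. (R \<omega> - 1)\<^sup>2) = expectation (\<lambda>x. (r x - 1)\<^sup>2) / B"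
    unfolding R1 power_divide using S(2) B by (simp add: power2_eq_square)
  have comp: "integrable ?N (\<lambda>\<omega>. r (\<omega> b)) \<and> P.expectation (\<lambda>\<omega>. r (\<omega> b)) = 1" if "b < B" for b
  proof -
    have [measurable]: "(\<lambda>\<omega>. \<omega> b) \<in> measurable ?N M"
      using that by (intro measurable_component_singleton) simp
    have d: "distr ?N M (\<lambda>\<omega>. \<omega> b) = M" using P.PiM_component[of b] that by simp
    show ?thesis
      using integrable_distr_eq[of "\<lambda>\<omega>. \<omega> b" ?N M r] integral_distr[of "\<lambda>\<omega>. \<omega> b" ?N M r] ir er
      by (simp add: d)
  qed
  have ER: "P.expectation R = 1"
    unfolding R_def using comp B by (simp add: Bochner_Integration.integral_sum)
  let ?u = "\<lambda>\<omega>. enn2real (u \<omega>)"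
  have ueq: "ennreal (?u \<omega>) = u \<omega>" if "\<omega> \<in> space ?N" for \<omega>
    using u1[OF that] by (intro ennreal_enn2real) (auto intro: le_less_trans)
  have u01: "0 \<le> ?u \<omega> \<and> ?u \<omega> \<le> 1" if "\<omega> \<in> space ?N" for \<omega>
    using u1[OF that] enn2real_mono[of "u \<omega>" 1] by simp
  note C = P.expectation_change_of_measure_le[of ?u R, OF _ _ u01 R2 ER, simplified]
  have iu: "integrable ?N ?u" by (rule P.integrable_const_bound[of _ 1]) (use u01 in auto)
  have "(\<integral>\<^sup>+\<omega>. u \<omega> \<partial>?N) = (\<integral>\<^sup>+\<omega>. ennreal (?u \<omega>) \<partial>?N)"
    by (intro nn_integral_cong) (simp add: ueq)
  also have "\<dots> = ennreal (P.expectation ?u)"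
    by (rule nn_integral_eq_integral[OF iu]) simp
  also have "\<dots> \<le> ennreal (P.expectation (\<lambda>\<omega>. R \<omega> * ?u \<omega>) + sqrt (P.expectation (\<lambda>x. (R x - 1)\<^sup>2)) / 2)"
    using C(2) by (intro ennreal_leI) simp
  also have "\<dots> = ennreal (P.expectation (\<lambda>\<omega>. R \<omega> * ?u \<omega>)) + ennreal (sqrt (P.expectation (\<lambda>x. (R x - 1)\<^sup>2)) / 2)"
    by (rule ennreal_plus) (auto intro!: integral_nonneg_AE AE_I2 mult_nonneg_nonneg R0)
  also have "ennreal (P.expectation (\<lambda>\<omega>. R \<omega> * ?u \<omega>)) = (\<integral>\<^sup>+\<omega>. ennreal (R \<omega> * ?u \<omega>) \<partial>?N)"
    using C(1) by (intro nn_integral_eq_integral[symmetric]) (auto intro!: AE_I2 mult_nonneg_nonneg R0)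
  also have "\<dots> = ?I"
    by (intro nn_integral_cong) (simp add: ennreal_mult' R0 ueq R_def[symmetric])
  also have "ennreal (sqrt (P.expectation (\<lambda>x. (R x - 1)\<^sup>2)) / 2)
      = sqrt_enn (\<integral>\<^sup>+x. ennreal ((r x - 1)\<^sup>2) \<partial>M) / ennreal (2 * sqrt B)"
  proof -
    have "(\<integral>\<^sup>+x. ennreal ((r x - 1)\<^sup>2) \<partial>M) = ennreal (expectation (\<lambda>x. (r x - 1)\<^sup>2))"
      by (rule nn_integral_eq_integral[OF h2]) simp
    then show ?thesis
      using B by (simp add: sqrt_enn_def E2 divide_ennreal real_sqrt_divide mult.commute)
  qed
  finally show ?thesis .
qed

lemma (in prob_space) nn_integral_PiM_average:
  fixes B :: nat
  assumes r[measurable]: "r \<in> borel_measurable M" and r0: "\<And>x. x \<in> space M \<Longrightarrow> 0 \<le> r x"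
    and r1: "(\<integral>\<^sup>+x. ennreal (r x) \<partial>M) = 1" and B: "1 \<le> B"
  shows "(\<integral>\<^sup>+\<omega>. ennreal ((\<Sum>b<B. r (\<omega> b)) / B) \<partial>PiM {..<B} (\<lambda>_. M)) = 1"
proof -
  interpret P: product_prob_space "\<lambda>_. M" "{..<B}" by standard
  let ?N = "PiM {..<B} (\<lambda>_. M)"
  have comp: "(\<integral>\<^sup>+\<omega>. ennreal (r (\<omega> b)) \<partial>?N) = 1" if "b < B" for b
  proof -
    have [measurable]: "(\<lambda>\<omega>. \<omega> b) \<in> measurable ?N M"
      using that by (intro measurable_component_singleton) simp
    have d: "distr ?N M (\<lambda>\<omega>. \<omega> b) = M" using P.PiM_component[of b] that by simp
    show ?thesis
      using nn_integral_distr[of "\<lambda>\<omega>. \<omega> b" ?N M "\<lambda>x. ennreal (r x)"] r1 unfolding d by simp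
  qed
  have "(\<integral>\<^sup>+\<omega>. ennreal ((\<Sum>b<B. r (\<omega> b)) / B) \<partial>?N) = (\<integral>\<^sup>+\<omega>. (\<Sum>b<B. ennreal (r (\<omega> b))) / ennreal B \<partial>?N)"
  proof (intro nn_integral_cong)
    fix \<omega> assume "\<omega> \<in> space ?N"
    then have "0 \<le> r (\<omega> b)" if "b < B" for b using that r0 by (auto simp: space_PiM)
    then show "ennreal ((\<Sum>b<B. r (\<omega> b)) / B) = (\<Sum>b<B. ennreal (r (\<omega> b))) / ennreal B"
      using B by (subst sum_ennreal, simp, subst divide_ennreal) (auto intro: sum_nonneg)
  qed
  also have "\<dots> = (\<Sum>b<B. \<integral>\<^sup>+\<omega>. ennreal (r (\<omega> b)) \<partial>?N) / ennreal B"
    by (subst nn_integral_divide) (auto simp: nn_integral_sum)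
  also have "\<dots> = 1" using comp B by (simp add: ennreal_of_nat_eq_real_of_nat)
  finally show ?thesis .
qed

section \<open>Product measures: densities and permutations\<close>

text \<open>Both measures agree on boxes, because the density and the indicator of a box factorise
  over the coordinates. Sigma-finiteness of the weighted measure is a separate assumption, as
  \<open>p\<close> may take the value infinity.\<close>

lemma PiM_density:
  assumes "sigma_finite_measure M" and I: "finite I" and [measurable]: "p \<in> borel_measurable M"
    and "sigma_finite_measure (density M p)"
  shows "PiM I (\<lambda>_. density M p) = density (PiM I (\<lambda>_. M)) (\<lambda>\<omega>. \<Prod>i\<in>I. p (\<omega> i))"
proof -
  interpret D: product_sigma_finite "\<lambda>_. density M p"
    using assms(4) by (simp add: product_sigma_finite_def)
  interpret S: product_sigma_finite "\<lambda>_. M"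
    using assms(1) by (simp add: product_sigma_finite_def)
  have *: "sets (PiM I (\<lambda>_. density M p)) = sets (PiM I (\<lambda>_. M))"
    by (intro sets_PiM_cong) auto
  show ?thesis
  proof (rule D.PiM_eqI[symmetric, OF I])
    fix A assume "\<And>i. i \<in> I \<Longrightarrow> A i \<in> sets (density M p)"
    then have [measurable]: "A i \<in> sets M" if "i \<in> I" for i using that by simp
    have box: "Pi\<^sub>E I A \<in> sets (PiM I (\<lambda>_. M))" using I by (intro sets_PiM_I_finite) auto
    have "emeasure (density (PiM I (\<lambda>_. M)) (\<lambda>\<omega>. \<Prod>i\<in>I. p (\<omega> i))) (Pi\<^sub>E I A)
        = (\<integral>\<^sup>+\<omega>. (\<Prod>i\<in>I. p (\<omega> i)) * indicator (Pi\<^sub>E I A) \<omega> \<partial>PiM I (\<lambda>_. M))"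
      using box I by (intro emeasure_density) auto
    also have "\<dots> = (\<integral>\<^sup>+\<omega>. (\<Prod>i\<in>I. p (\<omega> i) * indicator (A i) (\<omega> i)) \<partial>PiM I (\<lambda>_. M))"
    proof (intro nn_integral_cong)
      fix \<omega> assume "\<omega> \<in> space (PiM I (\<lambda>_. M))"
      then have "indicator (Pi\<^sub>E I A) \<omega> = (\<Prod>i\<in>I. indicator (A i) (\<omega> i) :: ennreal)"
        using I by (auto simp: indicator_def space_PiM PiE_iff)
      then show "(\<Prod>i\<in>I. p (\<omega> i)) * indicator (Pi\<^sub>E I A) \<omega> = (\<Prod>i\<in>I. p (\<omega> i) * indicator (A i) (\<omega> i))"
        by (simp add: prod.distrib)
    qed
    also have "\<dots> = (\<Prod>i\<in>I. \<integral>\<^sup>+x. p x * indicator (A i) x \<partial>M)"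
      using I by (intro S.product_nn_integral_prod) auto
    also have "\<dots> = (\<Prod>i\<in>I. emeasure (density M p) (A i))"
      by (intro prod.cong refl) (simp add: emeasure_density)
    finally show "emeasure (density (PiM I (\<lambda>_. M)) (\<lambda>\<omega>. \<Prod>i\<in>I. p (\<omega> i))) (Pi\<^sub>E I A)
      = (\<Prod>i\<in>I. emeasure (density M p) (A i))" .
  qed (simp add: *)
qed

lemma measurable_permute_PiM:
  assumes "\<sigma> permutes I"
  shows "(\<lambda>z. restrict (z \<circ> \<sigma>) I) \<in> measurable (PiM I (\<lambda>_. M)) (PiM I (\<lambda>_. M))"
  unfolding comp_def
  using permutes_in_image[OF assms] by (intro measurable_restrict measurable_component_singleton) simp

text \<open>Permuting coordinates carries boxes to boxes with permuted sides, and a finite product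
  does not depend on the order of its factors.\<close>

lemma distr_PiM_permute:
  assumes "sigma_finite_measure M" and I: "finite I" and \<sigma>: "\<sigma> permutes I"
  shows "distr (PiM I (\<lambda>_. M)) (PiM I (\<lambda>_. M)) (\<lambda>z. restrict (z \<circ> \<sigma>) I) = PiM I (\<lambda>_. M)"
proof -
  interpret S: product_sigma_finite "\<lambda>_. M"
    using assms(1) by (simp add: product_sigma_finite_def)
  show ?thesis
  proof (rule S.PiM_eqI[OF I])
    fix A assume A: "\<And>i. i \<in> I \<Longrightarrow> A i \<in> sets M"
    \<comment> \<open>Coordinate \<open>j\<close> of \<open>z\<close> is read at position
      \<open>inv \<sigma> j\<close> of the permuted vector, so it has to lie in the side with that
      index.\<close>
    let ?A = "A \<circ> inv \<sigma>"
    have A': "?A i \<in> sets M" if "i \<in> I" for i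
      using A[of "inv \<sigma> i"] that permutes_in_image[OF permutes_inv[OF \<sigma>]] by simp
    have box: "Pi\<^sub>E I A \<in> sets (PiM I (\<lambda>_. M))" using I A by (intro sets_PiM_I_finite) auto
    have "(\<lambda>z. restrict (z \<circ> \<sigma>) I) -` Pi\<^sub>E I A \<inter> space (PiM I (\<lambda>_. M)) = Pi\<^sub>E I ?A"
    proof (intro set_eqI iffI)
      fix z assume z: "z \<in> (\<lambda>z. restrict (z \<circ> \<sigma>) I) -` Pi\<^sub>E I A \<inter> space (PiM I (\<lambda>_. M))"
      have "z i \<in> ?A i" if "i \<in> I" for i
      proof -
        have "inv \<sigma> i \<in> I" using that permutes_in_image[OF permutes_inv[OF \<sigma>]] by simp
        then have "z (\<sigma> (inv \<sigma> i)) \<in> A (inv \<sigma> i)" using z by (force simp: PiE_iff)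
        then show ?thesis by (simp add: permutes_inverses[OF \<sigma>])
      qed
      then show "z \<in> Pi\<^sub>E I ?A" using z by (auto simp: space_PiM PiE_iff)
    next
      fix z assume z: "z \<in> Pi\<^sub>E I ?A"
      have "z (\<sigma> i) \<in> A i" if "i \<in> I" for i
        using z that permutes_in_image[OF \<sigma>, of i]
        by (auto simp: PiE_iff permutes_inverses[OF \<sigma>] dest!: bspec[of _ _ "\<sigma> i"])
      moreover have "z \<in> space (PiM I (\<lambda>_. M))"
        using z A'[THEN sets.sets_into_space] by (fastforce simp: space_PiM PiE_iff)
      ultimately show "z \<in> (\<lambda>z. restrict (z \<circ> \<sigma>) I) -` Pi\<^sub>E I A \<inter> space (PiM I (\<lambda>_. M))"
        by simp
    qed
    then have "emeasure (distr (PiM I (\<lambda>_. M)) (PiM I (\<lambda>_. M)) (\<lambda>z. restrict (z \<circ> \<sigma>) I)) (Pi\<^sub>E I A)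
        = emeasure (PiM I (\<lambda>_. M)) (Pi\<^sub>E I ?A)"
      by (subst emeasure_distr[OF measurable_permute_PiM[OF \<sigma>] box]) simp
    also have "\<dots> = (\<Prod>i\<in>I. emeasure M (?A i))"
      using A' I by (intro S.emeasure_PiM) auto
    also have "\<dots> = (\<Prod>i\<in>I. emeasure M (A i))"
      by (subst prod.permute[OF \<sigma>]) (simp add: permutes_inverses[OF \<sigma>] comp_def)
    finally show "emeasure (distr (PiM I (\<lambda>_. M)) (PiM I (\<lambda>_. M)) (\<lambda>z. restrict (z \<circ> \<sigma>) I)) (Pi\<^sub>E I A)
       = (\<Prod>i\<in>I. emeasure M (A i))" .
  qed simp
qed

text \<open>Change of variables: a symmetric density with respect to a permutation-invariant base
  measure gives an invariant law.\<close>

lemma distr_density_PiM_permute: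
  assumes "sigma_finite_measure M" and I: "finite I" and \<sigma>: "\<sigma> permutes I"
    and q[measurable]: "q \<in> borel_measurable (PiM I (\<lambda>_. M))"
    and inv: "\<And>z. z \<in> space (PiM I (\<lambda>_. M)) \<Longrightarrow> q (restrict (z \<circ> \<sigma>) I) = q z"
  shows "distr (density (PiM I (\<lambda>_. M)) q) (PiM I (\<lambda>_. M)) (\<lambda>z. restrict (z \<circ> \<sigma>) I)
    = density (PiM I (\<lambda>_. M)) q" (is "distr (density ?P q) ?P ?T = _")
proof (rule measure_eqI)
  have T[measurable]: "?T \<in> measurable ?P ?P" by (rule measurable_permute_PiM[OF \<sigma>])
  fix A assume "A \<in> sets (distr (density ?P q) ?P ?T)"
  then have A[measurable]: "A \<in> sets ?P" by simp
  have "emeasure (distr (density ?P q) ?P ?T) A = emeasure (density ?P q) (?T -` A \<inter> space ?P)"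
    by (subst emeasure_distr) auto
  also have "\<dots> = (\<integral>\<^sup>+z. q z * indicator (?T -` A \<inter> space ?P) z \<partial>?P)"
    by (intro emeasure_density) auto
  also have "\<dots> = (\<integral>\<^sup>+z. q (?T z) * indicator A (?T z) \<partial>?P)"
    by (intro nn_integral_cong) (simp add: inv indicator_def)
  also have "\<dots> = (\<integral>\<^sup>+z. q z * indicator A z \<partial>distr ?P ?P ?T)"
    by (subst nn_integral_distr) auto
  also have "\<dots> = emeasure (density ?P q) A"
    by (simp add: distr_PiM_permute[OF assms(1) I \<sigma>] emeasure_density)
  finally show "emeasure (distr (density ?P q) ?P ?T) A = emeasure (density ?P q) A" .
qed simp

section \<open>Total variation\<close>

lemma measure_diff_le_tv_dist:
  assumes "prob_space P" "prob_space Q" "A \<in> sets P"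
  shows "\<bar>measure P A - measure Q A\<bar> \<le> tv_dist P Q"
proof -
  have "\<bar>measure P A - measure Q A\<bar> \<le> 1" for A
    using prob_space.prob_le_1[OF assms(1), of A] prob_space.prob_le_1[OF assms(2), of A]
      measure_nonneg[of P A] measure_nonneg[of Q A] by linarith
  then show ?thesis
    unfolding tv_dist_def using assms(3) by (intro cSUP_upper) (auto intro!: bdd_aboveI[of _ 1])
qed

lemma tv_dist_nonneg: "prob_space P \<Longrightarrow> prob_space Q \<Longrightarrow> 0 \<le> tv_dist P Q"
  using measure_diff_le_tv_dist[of P Q "{}"] by simp

text \<open>One-sided bounds suffice: apply them to the complement.\<close>
lemma tv_dist_le:
  assumes P: "prob_space P" and Q: "prob_space Q" and s: "sets Q = sets P"
    and le: "\<And>A. A \<in> sets P \<Longrightarrow> emeasure P A \<le> emeasure Q A + c"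
  shows "ennreal (tv_dist P Q) \<le> c"
proof (cases c)
  case (real e)
  interpret P: prob_space P by fact
  interpret Q: prob_space Q by fact
  have le': "measure P A \<le> measure Q A + e" if "A \<in> sets P" for A
    using le[OF that] real
    by (simp add: P.emeasure_eq_measure Q.emeasure_eq_measure flip: ennreal_plus)
  have "\<bar>measure P A - measure Q A\<bar> \<le> e" if A: "A \<in> sets P" for A
  proof -
    have "measure Q (space P - A) = 1 - measure Q A"
      using Q.prob_compl[of A] A s sets_eq_imp_space_eq[OF s] by simp
    then show ?thesis
      using le'[OF A] le'[of "space P - A"] P.prob_compl[OF A] A by (simp add: abs_le_iff)
  qed
  then have "tv_dist P Q \<le> e"
    unfolding tv_dist_def by (intro cSUP_least) (auto intro: sets.top)
  then show ?thesis using real by (simp add: ennreal_leI)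
qed simp

text \<open>Passes from events to test functions with values in [0,1]. Since \<open>k\<close> is at
  most 1, the gain from replacing \<open>q\<close> by \<open>p\<close> is at most the integral of
  the positive part of p - q, which is the difference of the two probabilities of a single
  event.\<close>

lemma nn_integral_le_tv_dist:
  fixes p q k :: "'a \<Rightarrow> ennreal"
  assumes [measurable]: "p \<in> borel_measurable M" "q \<in> borel_measurable M" "k \<in> borel_measurable M"
    and p: "(\<integral>\<^sup>+x. p x \<partial>M) = 1" and q: "(\<integral>\<^sup>+x. q x \<partial>M) = 1"
    and k: "\<And>x. x \<in> space M \<Longrightarrow> k x \<le> 1"
  shows "(\<integral>\<^sup>+x. p x * k x \<partial>M) \<le> (\<integral>\<^sup>+x. q x * k x \<partial>M) + ennreal (tv_dist (density M p) (density M q))"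
proof -
  interpret P: prob_space "density M p" by standard (simp add: emeasure_density p cong: nn_integral_cong)
  interpret Q: prob_space "density M q" by standard (simp add: emeasure_density q cong: nn_integral_cong)
  \<comment> \<open>The event on which the positive part of p - q lives.\<close>
  define S where "S = {x \<in> space M. q x \<le> p x}"
  have S[measurable]: "S \<in> sets M" unfolding S_def by measurable
  have "(\<integral>\<^sup>+x. p x * k x \<partial>M) \<le> (\<integral>\<^sup>+x. q x * k x + (p x - q x) * indicator S x \<partial>M)"
  proof (rule nn_integral_mono)
    fix x assume x: "x \<in> space M"
    show "p x * k x \<le> q x * k x + (p x - q x) * indicator S x"
    proof (cases "q x \<le> p x")
      case True
      have "p x * k x = (q x + (p x - q x)) * k x" using True by (simp add: add_diff_inverse_ennreal)
      also have "\<dots> \<le> q x * k x + (p x - q x)"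
        using mult_left_mono[OF k[OF x], of "p x - q x"] by (simp add: distrib_right)
      finally show ?thesis using True x by (simp add: S_def)
    next
      case False
      then have "p x * k x \<le> q x * k x" by (intro mult_right_mono) auto
      then show ?thesis by (simp add: add_increasing2)
    qed
  qed
  also have "\<dots> = (\<integral>\<^sup>+x. q x * k x \<partial>M) + (\<integral>\<^sup>+x. (p x - q x) * indicator S x \<partial>M)"
    by (intro nn_integral_add) auto
  also have "(\<integral>\<^sup>+x. (p x - q x) * indicator S x \<partial>M) = (\<integral>\<^sup>+x. p x * indicator S x - q x * indicator S x \<partial>M)"
    by (intro nn_integral_cong) (simp add: indicator_def)
  also have "\<dots> = (\<integral>\<^sup>+x. p x * indicator S x \<partial>M) - (\<integral>\<^sup>+x. q x * indicator S x \<partial>M)"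
  proof (rule nn_integral_diff)
    have "(\<integral>\<^sup>+x. q x * indicator S x \<partial>M) \<le> (\<integral>\<^sup>+x. q x \<partial>M)"
      by (intro nn_integral_mono) (simp add: indicator_def)
    then show "(\<integral>\<^sup>+x. q x * indicator S x \<partial>M) \<noteq> \<infinity>" using q by (auto simp: top_unique)
  qed (auto simp: S_def indicator_def)
  also have "\<dots> = ennreal (measure (density M p) S) - ennreal (measure (density M q) S)"
    by (simp add: emeasure_density flip: P.emeasure_eq_measure Q.emeasure_eq_measure)
  also have "\<dots> \<le> ennreal (tv_dist (density M p) (density M q))"
    using measure_diff_le_tv_dist[OF P.prob_space_axioms Q.prob_space_axioms, of S]
    by (simp add: ennreal_minus ennreal_leI)
  finally show ?thesis by (simp add: add_left_mono)
qed

lemma measurable_sqrt_enn[measurable]: "sqrt_enn \<in> borel_measurable borel"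
  unfolding sqrt_enn_def by measurable

lemma atMost_eq_insert_0: "{..M::nat} = insert 0 {1..M}"
  by auto

section \<open>The resampling model\<close>

locale resampling_model = MX: sigma_finite_measure MX + MT: sigma_finite_measure MT
  for MX :: "'x measure" and MT :: "'t measure" +
  fixes f :: "'t \<Rightarrow> 'x \<Rightarrow> real" and \<pi> :: "'t \<Rightarrow> real" and B :: nat
  assumes f_meas: "(\<lambda>(\<theta>, x). f \<theta> x) \<in> borel_measurable (MT \<Otimes>\<^sub>M MX)"
    and f_nonneg: "\<And>\<theta> x. \<theta> \<in> space MT \<Longrightarrow> x \<in> space MX \<Longrightarrow> 0 \<le> f \<theta> x"
    and f_dens: "\<And>\<theta>. \<theta> \<in> space MT \<Longrightarrow> (\<integral>\<^sup>+ x. ennreal (f \<theta> x) \<partial>MX) = 1"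
    and pi_meas[measurable]: "\<pi> \<in> borel_measurable MT"
    and pi_pos: "\<And>\<theta>. \<theta> \<in> space MT \<Longrightarrow> 0 < \<pi> \<theta>"
    and pi_dens: "(\<integral>\<^sup>+ \<theta>. ennreal (\<pi> \<theta>) \<partial>MT) = 1"
    and supp: "\<And>\<theta> x. \<theta> \<in> space MT \<Longrightarrow> x \<in> space MX \<Longrightarrow> 0 < f \<theta> x \<Longrightarrow> 0 < margE MT f \<pi> x"
    and B: "1 \<le> B"
begin

section \<open>Sigma-finiteness and measurability\<close>

abbreviation TB :: "(nat \<Rightarrow> 't) measure" where "TB \<equiv> PiM {..<B} (\<lambda>_. MT)"
abbreviation gn :: "(nat \<Rightarrow> 't) \<Rightarrow> ennreal" where "gn \<equiv> g_norm MX MT f \<pi> B"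
abbreviation gu :: "(nat \<Rightarrow> 't) \<Rightarrow> 'x \<Rightarrow> real" where "gu \<equiv> g_un MT f \<pi> B"
abbreviation gd :: "(nat \<Rightarrow> 't) \<Rightarrow> 'x \<Rightarrow> real" where "gd \<equiv> g_dens MX MT f \<pi> B"
abbreviation post_prod :: "'x \<Rightarrow> (nat \<Rightarrow> 't) \<Rightarrow> real" where
  "post_prod x th \<equiv> \<Prod>b<B. post MT f \<pi> x (th b)"

sublocale T: product_sigma_finite "\<lambda>_::nat. MT"
  by standard

sublocale X: product_sigma_finite "\<lambda>_::nat. MX"
  by standard

sublocale TB: sigma_finite_measure TB
  by (rule T.sigma_finite) simp

sublocale XTB: pair_sigma_finite MX TB
  by standard

lemma measurable_f[measurable (raw)]:
  assumes [measurable]: "g \<in> measurable N MT" "h \<in> measurable N MX"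
  shows "(\<lambda>x. f (g x) (h x)) \<in> borel_measurable N"
  using measurable_compose[OF measurable_Pair[OF assms] f_meas] by simp

lemma measurable_margE[measurable (raw)]:
  assumes [measurable]: "\<rho> \<in> borel_measurable MT" "h \<in> measurable N MX"
  shows "(\<lambda>x. margE MT f \<rho> (h x)) \<in> borel_measurable N"
  unfolding margE_def by measurable

lemma measurable_marg[measurable (raw)]:
  assumes [measurable]: "\<rho> \<in> borel_measurable MT" "h \<in> measurable N MX"
  shows "(\<lambda>x. marg MT f \<rho> (h x)) \<in> borel_measurable N"
  unfolding marg_def by measurable

lemma measurable_post[measurable (raw)]:
  assumes [measurable]: "\<rho> \<in> borel_measurable MT" "h \<in> measurable N MX" "g \<in> measurable N MT"
  shows "(\<lambda>x. post MT f \<rho> (h x) (g x)) \<in> borel_measurable N"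
  unfolding post_def by measurable

lemma measurable_TB_component[measurable (raw)]:
  assumes "b < B" "t \<in> measurable N TB"
  shows "(\<lambda>x. t x b) \<in> measurable N MT"
  using assms by (intro measurable_compose[OF assms(2) measurable_component_singleton]) auto

lemma measurable_post_prod[measurable (raw)]:
  assumes [measurable]: "h \<in> measurable N MX" "t \<in> measurable N TB"
  shows "(\<lambda>x. post_prod (h x) (t x)) \<in> borel_measurable N"
  by (intro borel_measurable_prod measurable_post measurable_TB_component) auto

lemma measurable_gu[measurable (raw)]:
  assumes [measurable]: "h \<in> measurable N MX" "t \<in> measurable N TB"
  shows "(\<lambda>x. gu (t x) (h x)) \<in> borel_measurable N"
  unfolding g_un_def
  by (intro borel_measurable_divide borel_measurable_prod borel_measurable_power
      measurable_f measurable_marg measurable_TB_component) auto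

lemma measurable_gn[measurable (raw)]:
  assumes [measurable]: "t \<in> measurable N TB"
  shows "(\<lambda>x. gn (t x)) \<in> borel_measurable N"
  unfolding g_norm_def by measurable

lemma measurable_gd[measurable (raw)]:
  assumes [measurable]: "h \<in> measurable N MX" "t \<in> measurable N TB"
  shows "(\<lambda>x. gd (t x) (h x)) \<in> borel_measurable N"
  unfolding g_dens_def by measurable

section \<open>Signs, normalisation of \<open>gd\<close>, and the resampling kernel\<close>

lemma space_TB: "th \<in> space TB \<Longrightarrow> b < B \<Longrightarrow> th b \<in> space MT"
  by (auto simp: space_PiM)

lemma post_nonneg:
  "0 \<le> \<rho> \<theta> \<Longrightarrow> \<theta> \<in> space MT \<Longrightarrow> x \<in> space MX \<Longrightarrow> 0 \<le> post MT f \<rho> x \<theta>"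
  unfolding post_def marg_def using f_nonneg by simp

lemma post_prod_nonneg: "th \<in> space TB \<Longrightarrow> x \<in> space MX \<Longrightarrow> 0 \<le> post_prod x th"
  by (intro prod_nonneg) (auto intro!: post_nonneg less_imp_le[OF pi_pos] simp: space_TB)

lemma gu_nonneg: "th \<in> space TB \<Longrightarrow> x \<in> space MX \<Longrightarrow> 0 \<le> gu th x"
  unfolding g_un_def marg_def by (intro divide_nonneg_nonneg prod_nonneg) (auto simp: f_nonneg space_TB)

lemma gd_nonneg: "th \<in> space TB \<Longrightarrow> x \<in> space MX \<Longrightarrow> 0 \<le> gd th x"
  unfolding g_dens_def by (simp add: gu_nonneg)

text \<open>Outside \<open>0 < gn th < \<infinity>\<close> the conventions \<open>enn2real \<infinity> = 0\<close> and \<open>a / 0 = 0\<close> make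
  \<open>gd th\<close> vanish.\<close>
lemma nn_integral_gd:
  assumes th[measurable]: "th \<in> space TB"
  shows "(\<integral>\<^sup>+y. ennreal (gd th y) \<partial>MX) = (if 0 < gn th \<and> gn th < \<infinity> then 1 else 0)"
proof (cases "0 < gn th \<and> gn th < \<infinity>")
  case True
  then have c: "0 < enn2real (gn th)" by (simp add: enn2real_positive_iff)
  have "(\<integral>\<^sup>+y. ennreal (gd th y) \<partial>MX) = (\<integral>\<^sup>+y. ennreal (gu th y) / ennreal (enn2real (gn th)) \<partial>MX)"
    using c th by (intro nn_integral_cong) (simp add: g_dens_def divide_ennreal gu_nonneg)
  also have "\<dots> = gn th / ennreal (enn2real (gn th))"
    by (subst nn_integral_divide) (auto simp: g_norm_def)
  also have "\<dots> = 1" using True ennreal_divide_self[of "gn th"] by auto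
  finally show ?thesis using True by simp
next
  case False
  then have "enn2real (gn th) = 0" by (auto simp: enn2real_eq_0_iff not_less top_unique)
  then show ?thesis using False by (simp add: g_dens_def)
qed

text \<open>For \<open>gn th\<close> positive and finite, this is the conditional probability that
  the whole vector lies in \<open>A\<close>, given first observation \<open>x\<close> and parameters
  \<open>th\<close>. The joint law and the comparison law share this kernel and differ only in the
  law of the pair (x, th).\<close>

definition resample :: "nat \<Rightarrow> (nat \<Rightarrow> 'x) set \<Rightarrow> 'x \<Rightarrow> (nat \<Rightarrow> 't) \<Rightarrow> ennreal" where
  "resample M A x th = (\<integral>\<^sup>+z. indicator A (z(0 := x)) * (\<Prod>m\<in>{1..M}. ennreal (gd th (z m)))
      \<partial>PiM {1..M} (\<lambda>_. MX))"

lemma measurable_PiM_atMost_upd[measurable (raw)]: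
  assumes "z \<in> measurable N (PiM {1..M::nat} (\<lambda>_. MX))" "h \<in> measurable N MX"
  shows "(\<lambda>x. (z x)(0 := h x)) \<in> measurable N (PiM {..M} (\<lambda>_. MX))"
  by (rule measurable_fun_upd[OF _ assms]) auto

text \<open>\<open>J\<close> may be smaller than \<open>I\<close>, because the product over the
  resamples 1..M is also read off vectors that contain the coordinate 0.\<close>

lemma measurable_prod_gd[measurable (raw)]:
  assumes z: "z \<in> measurable N (PiM I (\<lambda>_. MX))" and t: "t \<in> measurable N TB" and J: "J \<subseteq> I"
  shows "(\<lambda>x. \<Prod>m\<in>J. ennreal (gd (t x) (z x m))) \<in> borel_measurable N"
proof (intro borel_measurable_prod_ennreal measurable_compose[OF _ measurable_ennreal] measurable_gd t)
  fix m assume "m \<in> J"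
  then show "(\<lambda>x. z x m) \<in> measurable N MX"
    using J by (intro measurable_compose[OF z measurable_component_singleton]) auto
qed

lemma measurable_resample[measurable (raw)]:
  assumes [measurable]: "h \<in> measurable N MX" "t \<in> measurable N TB"
    and A[measurable]: "A \<in> sets (PiM {..M} (\<lambda>_. MX))"
  shows "(\<lambda>x. resample M A (h x) (t x)) \<in> borel_measurable N"
proof -
  interpret XM: sigma_finite_measure "PiM {1..M} (\<lambda>_. MX)" by (rule X.sigma_finite) simp
  show ?thesis unfolding resample_def by measurable
qed

lemma nn_integral_prod_gd:
  assumes [measurable]: "th \<in> space TB" and I: "finite (I :: nat set)"
  shows "(\<integral>\<^sup>+z. (\<Prod>m\<in>I. ennreal (gd th (z m))) \<partial>PiM I (\<lambda>_. MX))
    = (if 0 < gn th \<and> gn th < \<infinity> then 1 else 0) ^ card I"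
  using I by (subst X.product_nn_integral_prod) (auto simp: nn_integral_gd assms)

text \<open>The product of the \<open>gd\<close> factors has total mass 0 or 1, also for degenerate
  \<open>th\<close> and for M = 0, where the empty product has mass 1.\<close>

lemma resample_le_1:
  assumes th: "th \<in> space TB"
  shows "resample M A x th \<le> 1"
proof -
  have "resample M A x th \<le> (\<integral>\<^sup>+z. (\<Prod>m\<in>{1..M}. ennreal (gd th (z m))) \<partial>PiM {1..M} (\<lambda>_. MX))"
    unfolding resample_def by (intro nn_integral_mono) (simp add: indicator_def)
  also have "\<dots> \<le> 1" by (subst nn_integral_prod_gd[OF th]) (auto simp: power_0_left)
  finally show ?thesis .
qed

lemma resample_space:
  assumes th: "th \<in> space TB" and x: "x \<in> space MX" and gn: "0 < gn th" "gn th < \<infinity>"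
  shows "resample M (space (PiM {..M} (\<lambda>_. MX))) x th = 1"
proof -
  have "resample M (space (PiM {..M} (\<lambda>_. MX))) x th
      = (\<integral>\<^sup>+z. (\<Prod>m\<in>{1..M}. ennreal (gd th (z m))) \<partial>PiM {1..M} (\<lambda>_. MX))"
    unfolding resample_def
  proof (intro nn_integral_cong)
    fix z assume "z \<in> space (PiM {1..M} (\<lambda>_. MX))"
    then have "z(0 := x) \<in> space (PiM {..M} (\<lambda>_. MX))"
      using x by (auto simp: space_PiM PiE_iff extensional_def)
    then show "indicator (space (PiM {..M} (\<lambda>_. MX))) (z(0 := x)) * (\<Prod>m\<in>{1..M}. ennreal (gd th (z m)))
      = (\<Prod>m\<in>{1..M}. ennreal (gd th (z m)))" by simp
  qed
  then show ?thesis using gn by (subst (asm) nn_integral_prod_gd[OF th]) auto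
qed

text \<open>Coordinate 0 is split off the product measure and Fubini moves the integral over
  \<open>th\<close> outside the one over the resamples. The factor \<open>c\<close> is left general
  so that both the joint law and the comparison law are instances.\<close>

lemma emeasure_density_resample:
  assumes c[measurable]: "(\<lambda>(x, th). c x th) \<in> borel_measurable (MX \<Otimes>\<^sub>M TB)"
    and A[measurable]: "A \<in> sets (PiM {..M} (\<lambda>_. MX))"
  shows "emeasure (density (PiM {..M} (\<lambda>_. MX))
        (\<lambda>z. \<integral>\<^sup>+th. c (z 0) th * (\<Prod>m\<in>{1..M}. ennreal (gd th (z m))) \<partial>TB)) A
    = (\<integral>\<^sup>+x. \<integral>\<^sup>+th. c x th * resample M A x th \<partial>TB \<partial>MX)"
proof -
  interpret XM: sigma_finite_measure "PiM {1..M} (\<lambda>_. MX)" by (rule X.sigma_finite) simp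
  interpret XMT: pair_sigma_finite "PiM {1..M} (\<lambda>_. MX)" TB by standard
  have c'[measurable (raw)]: "(\<lambda>x. c (h x) (t x)) \<in> borel_measurable N"
    if "h \<in> measurable N MX" "t \<in> measurable N TB" for h t and N :: "'n measure"
    using measurable_compose[OF measurable_Pair[OF that] c] by simp
  have [measurable]: "(\<lambda>z. z 0) \<in> measurable (PiM {..M} (\<lambda>_. MX)) MX"
    by (rule measurable_component_singleton) simp
  let ?q = "\<lambda>z. \<integral>\<^sup>+th. c (z 0) th * (\<Prod>m\<in>{1..M}. ennreal (gd th (z m))) \<partial>TB"
  have q: "?q \<in> borel_measurable (PiM {..M} (\<lambda>_. MX))"
    by (intro TB.borel_measurable_nn_integral)
       (auto intro!: borel_measurable_times c' measurable_prod_gd[where I = "{..M}"] simp: split_beta')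
  have "emeasure (density (PiM {..M} (\<lambda>_. MX)) ?q) A
      = (\<integral>\<^sup>+z. ?q z * indicator A z \<partial>PiM (insert 0 {1..M}) (\<lambda>_. MX))"
    by (simp only: atMost_eq_insert_0[symmetric] emeasure_density[OF q A])
  also have "\<dots> = (\<integral>\<^sup>+x. \<integral>\<^sup>+z. ?q (z(0 := x)) * indicator A (z(0 := x)) \<partial>PiM {1..M} (\<lambda>_. MX) \<partial>MX)"
    using q A by (intro X.product_nn_integral_insert_rev) (auto simp only: atMost_eq_insert_0[symmetric] finite_atLeastAtMost atLeastAtMost_iff intro!: borel_measurable_times_ennreal borel_measurable_indicator)
  also have "\<dots> = (\<integral>\<^sup>+x. \<integral>\<^sup>+th. c x th * resample M A x th \<partial>TB \<partial>MX)"
  proof (intro nn_integral_cong)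
    fix x assume x[measurable]: "x \<in> space MX"
    have upd: "(\<Prod>m\<in>{1..M}. ennreal (gd th ((z(0 := x)) m))) = (\<Prod>m\<in>{1..M}. ennreal (gd th (z m)))" for z th
      by (intro prod.cong) auto
    have "(\<integral>\<^sup>+z. ?q (z(0 := x)) * indicator A (z(0 := x)) \<partial>PiM {1..M} (\<lambda>_. MX))
      = (\<integral>\<^sup>+z. \<integral>\<^sup>+th. c x th * (\<Prod>m\<in>{1..M}. ennreal (gd th (z m))) * indicator A (z(0 := x)) \<partial>TB
          \<partial>PiM {1..M} (\<lambda>_. MX))"
      by (intro nn_integral_cong, subst nn_integral_multc[symmetric]) (simp_all add: upd)
    also have "\<dots> = (\<integral>\<^sup>+th. \<integral>\<^sup>+z. c x th * (\<Prod>m\<in>{1..M}. ennreal (gd th (z m))) * indicator A (z(0 := x))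
          \<partial>PiM {1..M} (\<lambda>_. MX) \<partial>TB)"
      by (rule XMT.Fubini'[symmetric]) measurable
    also have "\<dots> = (\<integral>\<^sup>+th. c x th * resample M A x th \<partial>TB)"
      unfolding resample_def
      by (intro nn_integral_cong, subst nn_integral_cmult[symmetric]) (measurable, simp add: mult_ac)
    finally show "(\<integral>\<^sup>+z. ?q (z(0 := x)) * indicator A (z(0 := x)) \<partial>PiM {1..M} (\<lambda>_. MX))
      = (\<integral>\<^sup>+th. c x th * resample M A x th \<partial>TB)" .
  qed
  finally show ?thesis .
qed

section \<open>The joint law of the observation and its resamples\<close>

lemma sets_joint_law: "sets (joint_law MX MT f \<pi> \<theta>0 B M) = sets (PiM {..M} (\<lambda>_. MX))"
  by (simp add: joint_law_def)

lemma emeasure_joint_law: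
  assumes \<theta>0: "\<theta>0 \<in> space MT" and A: "A \<in> sets (PiM {..M} (\<lambda>_. MX))"
  shows "emeasure (joint_law MX MT f \<pi> \<theta>0 B M) A
    = (\<integral>\<^sup>+x. ennreal (f \<theta>0 x) * (\<integral>\<^sup>+th. ennreal (post_prod x th) * resample M A x th \<partial>TB) \<partial>MX)"
proof -
  note \<theta>0[measurable] A[measurable]
  let ?d = "\<lambda>z. ennreal (f \<theta>0 (z 0)) *
            (\<integral>\<^sup>+ th. ennreal (post_prod (z 0) th * (\<Prod>m\<in>{1..M}. gd th (z m))) \<partial>TB)"
  let ?e = "\<lambda>z. \<integral>\<^sup>+th. ennreal (f \<theta>0 (z 0)) * ennreal (post_prod (z 0) th)
                * (\<Prod>m\<in>{1..M}. ennreal (gd th (z m))) \<partial>TB"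
  have [measurable]: "(\<lambda>z. z 0) \<in> measurable (PiM {..M} (\<lambda>_. MX)) MX"
    by (rule measurable_component_singleton) simp
  have gdm[measurable]: "(\<lambda>p. \<Prod>m\<in>{1..M}. ennreal (gd (snd p) (fst p m)))
      \<in> borel_measurable (PiM {..M} (\<lambda>_. MX) \<Otimes>\<^sub>M TB)"
    by (rule measurable_prod_gd[where I = "{..M}"]) auto
  \<comment> \<open>The definition of \<open>joint_law\<close> multiplies reals before embedding
    them in \<open>ennreal\<close>; nonnegativity on the product space allows each factor to be
    embedded separately.\<close>
  have de: "?d z = ?e z" if z: "z \<in> space (PiM {..M} (\<lambda>_. MX))" for z
  proof -
    have [measurable]: "z m \<in> space MX" if "m \<le> M" for m using z that by (auto simp: space_PiM)
    have "?d z = ennreal (f \<theta>0 (z 0)) * (\<integral>\<^sup>+th. ennreal (post_prod (z 0) th)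
                * (\<Prod>m\<in>{1..M}. ennreal (gd th (z m))) \<partial>TB)"
    proof (intro arg_cong2[where f = "(*)"] refl nn_integral_cong)
      fix th assume th: "th \<in> space TB"
      have "(\<Prod>m\<in>{1..M}. ennreal (gd th (z m))) = ennreal (\<Prod>m\<in>{1..M}. gd th (z m))"
        using th z by (intro prod_ennreal gd_nonneg) (auto simp: space_PiM PiE_iff)
      then show "ennreal (post_prod (z 0) th * (\<Prod>m\<in>{1..M}. gd th (z m)))
          = ennreal (post_prod (z 0) th) * (\<Prod>m\<in>{1..M}. ennreal (gd th (z m)))"
        using th post_prod_nonneg[OF th, of "z 0"] z by (simp add: ennreal_mult' space_PiM PiE_iff)
    qed
    also have "\<dots> = ?e z"
    proof (subst nn_integral_cmult[symmetric])
      show "(\<lambda>th. ennreal (post_prod (z 0) th) * (\<Prod>m\<in>{1..M}. ennreal (gd th (z m)))) \<in> borel_measurable TB"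
        by (intro borel_measurable_times_ennreal borel_measurable_prod_ennreal
            measurable_compose[OF _ measurable_ennreal] measurable_gd measurable_post_prod) auto
    qed (simp add: mult.assoc)
    finally show ?thesis .
  qed
  have e: "?e \<in> borel_measurable (PiM {..M} (\<lambda>_. MX))"
    by (intro TB.borel_measurable_nn_integral)
       (auto intro!: borel_measurable_times gdm simp: split_beta')
  have "joint_law MX MT f \<pi> \<theta>0 B M = density (PiM {..M} (\<lambda>_. MX)) ?e"
    unfolding joint_law_def
    using e de measurable_cong[of "PiM {..M} (\<lambda>_. MX)" ?d ?e borel]
    by (intro density_cong AE_I2) auto
  then have "emeasure (joint_law MX MT f \<pi> \<theta>0 B M) A
      = (\<integral>\<^sup>+x. \<integral>\<^sup>+th. ennreal (f \<theta>0 x) * ennreal (post_prod x th) * resample M A x th \<partial>TB \<partial>MX)"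
    by (simp only:) (rule emeasure_density_resample[OF _ A], measurable)
  also have "\<dots> = (\<integral>\<^sup>+x. ennreal (f \<theta>0 x) * (\<integral>\<^sup>+th. ennreal (post_prod x th) * resample M A x th \<partial>TB) \<partial>MX)"
    by (intro nn_integral_cong, subst nn_integral_cmult[symmetric]) (measurable, simp add: mult.assoc)
  finally show ?thesis .
qed

section \<open>Marginal likelihoods and posteriors as probability densities\<close>

lemma nn_integral_margE:
  assumes [measurable]: "\<rho> \<in> borel_measurable MT" and \<rho>0: "\<And>\<theta>. \<theta> \<in> space MT \<Longrightarrow> 0 \<le> \<rho> \<theta>"
  shows "(\<integral>\<^sup>+x. margE MT f \<rho> x \<partial>MX) = (\<integral>\<^sup>+\<theta>. ennreal (\<rho> \<theta>) \<partial>MT)"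
proof -
  interpret XT: pair_sigma_finite MX MT by standard
  have "(\<integral>\<^sup>+x. margE MT f \<rho> x \<partial>MX) = (\<integral>\<^sup>+\<theta>. \<integral>\<^sup>+x. ennreal (\<rho> \<theta> * f \<theta> x) \<partial>MX \<partial>MT)"
    unfolding margE_def by (rule XT.Fubini'[symmetric]) measurable
  also have "\<dots> = (\<integral>\<^sup>+\<theta>. ennreal (\<rho> \<theta>) \<partial>MT)"
  proof (intro nn_integral_cong)
    fix \<theta> assume [measurable]: "\<theta> \<in> space MT"
    then show "(\<integral>\<^sup>+x. ennreal (\<rho> \<theta> * f \<theta> x) \<partial>MX) = ennreal (\<rho> \<theta>)"
      by (simp add: ennreal_mult' \<rho>0 nn_integral_cmult f_dens)
  qed
  finally show ?thesis .
qed

lemma nn_integral_post: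
  assumes [measurable]: "\<rho> \<in> borel_measurable MT" and \<rho>0: "\<And>\<theta>. \<theta> \<in> space MT \<Longrightarrow> 0 \<le> \<rho> \<theta>"
    and x[measurable]: "x \<in> space MX" and m: "0 < margE MT f \<rho> x" "margE MT f \<rho> x < \<infinity>"
  shows "(\<integral>\<^sup>+\<theta>. ennreal (post MT f \<rho> x \<theta>) \<partial>MT) = 1"
proof -
  have c: "0 < marg MT f \<rho> x" using m by (simp add: marg_def enn2real_positive_iff)
  have "(\<integral>\<^sup>+\<theta>. ennreal (post MT f \<rho> x \<theta>) \<partial>MT) = (\<integral>\<^sup>+\<theta>. ennreal (\<rho> \<theta> * f \<theta> x) / ennreal (marg MT f \<rho> x) \<partial>MT)"
    using c x by (intro nn_integral_cong) (simp add: post_def divide_ennreal \<rho>0 f_nonneg)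
  also have "\<dots> = margE MT f \<rho> x / ennreal (marg MT f \<rho> x)"
    by (subst nn_integral_divide) (auto simp: margE_def)
  also have "\<dots> = 1" using m ennreal_divide_self[of "margE MT f \<rho> x"] by (auto simp: marg_def)
  finally show ?thesis .
qed

end

section \<open>The exchangeable comparison law of a prior\<close>

text \<open>After the import the type variables are \<open>'a\<close> for observations and
  \<open>'b\<close> for parameters.\<close>

locale resampling_model_prior = resampling_model +
  fixes \<pi>0 :: "'b \<Rightarrow> real"
  assumes adm: "admissible_prior MX MT f \<pi>0"
begin

section \<open>Reweighting by the average posterior ratio\<close>

lemma pi0_meas[measurable]: "\<pi>0 \<in> borel_measurable MT"
  and pi0_nonneg: "\<theta> \<in> space MT \<Longrightarrow> 0 \<le> \<pi>0 \<theta>"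
  and pi0_dens: "(\<integral>\<^sup>+ \<theta>. ennreal (\<pi>0 \<theta>) \<partial>MT) = 1"
  and supp0: "\<theta> \<in> space MT \<Longrightarrow> x \<in> space MX \<Longrightarrow> 0 < f \<theta> x \<Longrightarrow> 0 < margE MT f \<pi>0 x"
  using adm by (auto simp: admissible_prior_def)

definition ratio :: "'a \<Rightarrow> 'b \<Rightarrow> real" where
  "ratio x \<theta> = post MT f \<pi>0 x \<theta> / post MT f \<pi> x \<theta>"

definition avg_ratio :: "'a \<Rightarrow> (nat \<Rightarrow> 'b) \<Rightarrow> real" where
  "avg_ratio x th = (\<Sum>b<B. ratio x (th b)) / B"

text \<open>On \<open>space TB\<close>, by positivity of \<pi>, this is the average over
  \<open>b\<close> of the product prior in which the factor \<pi> at \<open>b\<close> is replaced by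
  \<pi>0. It does not involve \<open>x\<close>, so given \<open>th\<close> the law of
  \<open>x\<close> keeps the shape \<open>gu th\<close>.\<close>

definition weight :: "(nat \<Rightarrow> 'b) \<Rightarrow> real" where
  "weight th = (\<Prod>b<B. \<pi> (th b)) * ((\<Sum>b<B. \<pi>0 (th b) / \<pi> (th b)) / B)"

text \<open>The points at which both posteriors are genuine probability densities, free of the
  defaults of \<open>enn2real\<close> and of division by zero.\<close>

definition regular :: "'a \<Rightarrow> bool" where
  "regular x \<longleftrightarrow> 0 < margE MT f \<pi> x \<and> margE MT f \<pi> x < \<infinity> \<and>
     0 < margE MT f \<pi>0 x \<and> margE MT f \<pi>0 x < \<infinity>"

lemma measurable_ratio[measurable (raw)]:
  assumes [measurable]: "h \<in> measurable N MX" "g \<in> measurable N MT"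
  shows "(\<lambda>x. ratio (h x) (g x)) \<in> borel_measurable N"
  unfolding ratio_def by measurable

lemma measurable_avg_ratio[measurable (raw)]:
  assumes [measurable]: "h \<in> measurable N MX" "t \<in> measurable N TB"
  shows "(\<lambda>x. avg_ratio (h x) (t x)) \<in> borel_measurable N"
  unfolding avg_ratio_def
  by (intro borel_measurable_divide borel_measurable_sum measurable_ratio measurable_TB_component) auto

lemma measurable_weight[measurable (raw)]:
  assumes [measurable]: "t \<in> measurable N TB"
  shows "(\<lambda>x. weight (t x)) \<in> borel_measurable N"
  unfolding weight_def
  by (intro borel_measurable_times borel_measurable_divide borel_measurable_sum borel_measurable_prod
      measurable_compose[OF measurable_TB_component pi_meas]
      measurable_compose[OF measurable_TB_component pi0_meas]) auto

lemma measurable_regular[measurable]: "Measurable.pred MX regular"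
  unfolding regular_def by measurable

lemma ratio_nonneg: "\<theta> \<in> space MT \<Longrightarrow> x \<in> space MX \<Longrightarrow> 0 \<le> ratio x \<theta>"
  unfolding ratio_def by (intro divide_nonneg_nonneg post_nonneg pi0_nonneg less_imp_le[OF pi_pos])

lemma weight_nonneg: "th \<in> space TB \<Longrightarrow> 0 \<le> weight th"
  unfolding weight_def
  by (intro mult_nonneg_nonneg prod_nonneg divide_nonneg_nonneg sum_nonneg)
     (auto simp: space_TB pi0_nonneg less_imp_le[OF pi_pos])

text \<open>Two factorisations of one joint density, with F and H the marginal likelihoods of \<pi>
  and \<pi>0: parameters first on the left; on the right, the observation with density H first and
  then the tilted posterior product. The \<open>B\<close> posteriors contribute F to the power -B
  and the average ratio contributes F / H, which leaves the power B - 1 in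
  \<open>gu\<close>.\<close>

lemma weight_gu_eq:
  assumes x: "x \<in> space MX" and reg: "regular x" and th: "th \<in> space TB"
  shows "weight th * gu th x = marg MT f \<pi>0 x * (post_prod x th * avg_ratio x th)"
proof (cases "\<exists>b<B. f (th b) x = 0")
  \<comment> \<open>Both sides vanish. The case is separate because \<open>ratio\<close> is then 0
    by the convention for division by zero, instead of the prior ratio times F / H.\<close>
  case True
  then have "(\<Prod>b<B. f (th b) x) = 0" "post_prod x th = 0"
    by (auto intro!: prod_zero simp: post_def)
  then show ?thesis unfolding g_un_def by (simp only: div_0 mult_zero_left mult_zero_right)
next
  case False
  define F where "F = marg MT f \<pi> x"
  define H where "H = marg MT f \<pi>0 x"
  have F: "0 < F" and H: "0 < H"
    using reg by (auto simp: regular_def F_def H_def marg_def enn2real_positive_iff)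
  \<comment> \<open>The likelihood cancels in the quotient of the two posteriors.\<close>
  have r: "ratio x (th b) = F / H * (\<pi>0 (th b) / \<pi> (th b))" if "b < B" for b
    using False that pi_pos[OF space_TB[OF th that]] F H
    unfolding ratio_def post_def F_def[symmetric] H_def[symmetric] by (simp add: field_simps)
  have a: "avg_ratio x th = F / H * ((\<Sum>b<B. \<pi>0 (th b) / \<pi> (th b)) / B)"
    unfolding avg_ratio_def by (simp add: r sum_distrib_left)
  have p: "post_prod x th = (\<Prod>b<B. \<pi> (th b)) * (\<Prod>b<B. f (th b) x) / F ^ B"
    unfolding post_def F_def[symmetric] by (simp add: prod_dividef prod.distrib)
  have "F ^ B = F * F ^ (B - 1)" using B by (cases B) auto
  then show ?thesis
    unfolding a p weight_def g_un_def H_def[symmetric] F_def[symmetric] using F H by (simp add: mult_ac)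
qed

section \<open>Integration against the posterior\<close>

lemma prob_space_post:
  assumes "x \<in> space MX" "regular x"
  shows "prob_space (density MT (\<lambda>\<theta>. ennreal (post MT f \<pi> x \<theta>)))"
proof
  note assms(1)[measurable]
  show "emeasure (density MT (\<lambda>\<theta>. ennreal (post MT f \<pi> x \<theta>))) (space (density MT (\<lambda>\<theta>. ennreal (post MT f \<pi> x \<theta>)))) = 1"
    using nn_integral_post[of \<pi> x] assms pi_pos
    by (auto simp: emeasure_density regular_def less_imp_le cong: nn_integral_cong)
qed

text \<open>Translates between the product of posterior probability spaces, where the averaging
  lemmas apply, and densities on \<open>TB\<close>, in which the laws are written.\<close>

lemma nn_integral_TB_post_prod:
  assumes x[measurable]: "x \<in> space MX" and reg: "regular x" and [measurable]: "h \<in> borel_measurable TB"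
  shows "(\<integral>\<^sup>+th. h th \<partial>PiM {..<B} (\<lambda>_. density MT (\<lambda>\<theta>. ennreal (post MT f \<pi> x \<theta>))))
     = (\<integral>\<^sup>+th. ennreal (post_prod x th) * h th \<partial>TB)"
proof -
  interpret D: prob_space "density MT (\<lambda>\<theta>. ennreal (post MT f \<pi> x \<theta>))"
    by (rule prob_space_post[OF x reg])
  have "PiM {..<B} (\<lambda>_. density MT (\<lambda>\<theta>. ennreal (post MT f \<pi> x \<theta>)))
      = density TB (\<lambda>th. \<Prod>b<B. ennreal (post MT f \<pi> x (th b)))"
    by (rule PiM_density) (auto intro: MT.sigma_finite_measure_axioms D.sigma_finite_measure_axioms)
  also have "\<dots> = density TB (\<lambda>th. ennreal (post_prod x th))"
  proof (intro density_cong AE_I2)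
    fix th assume "th \<in> space TB"
    then show "(\<Prod>b<B. ennreal (post MT f \<pi> x (th b))) = ennreal (post_prod x th)"
      using x by (intro prod_ennreal post_nonneg less_imp_le[OF pi_pos]) (auto simp: space_TB)
  qed measurable
  finally show ?thesis by (simp add: nn_integral_density)
qed

lemma nn_integral_ratio:
  assumes x[measurable]: "x \<in> space MX" and reg: "regular x"
  shows "(\<integral>\<^sup>+\<theta>. ennreal (ratio x \<theta>) \<partial>density MT (\<lambda>\<theta>. ennreal (post MT f \<pi> x \<theta>))) = 1"
proof -
  have "(\<integral>\<^sup>+\<theta>. ennreal (ratio x \<theta>) \<partial>density MT (\<lambda>\<theta>. ennreal (post MT f \<pi> x \<theta>)))
      = (\<integral>\<^sup>+\<theta>. ennreal (post MT f \<pi> x \<theta>) * ennreal (ratio x \<theta>) \<partial>MT)"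
    by (rule nn_integral_density) measurable
  also have "\<dots> = (\<integral>\<^sup>+\<theta>. ennreal (post MT f \<pi>0 x \<theta>) \<partial>MT)"
  proof (intro nn_integral_cong)
    fix \<theta> assume \<theta>: "\<theta> \<in> space MT"
    \<comment> \<open>Since \<pi> and its marginal at \<open>x\<close> are positive, the
      \<pi>-posterior vanishes only where the likelihood does, and there the other posterior
      vanishes too. So \<open>ratio\<close> is a true Radon-Nikodym derivative despite its default
      value 0.\<close>
    have "0 < marg MT f \<pi> x" using reg by (auto simp: regular_def marg_def enn2real_positive_iff)
    then have "post MT f \<pi> x \<theta> = 0 \<longrightarrow> post MT f \<pi>0 x \<theta> = 0"
      using pi_pos[OF \<theta>] by (auto simp: post_def)
    then have "post MT f \<pi> x \<theta> * ratio x \<theta> = post MT f \<pi>0 x \<theta>" by (auto simp: ratio_def)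
    then show "ennreal (post MT f \<pi> x \<theta>) * ennreal (ratio x \<theta>) = ennreal (post MT f \<pi>0 x \<theta>)"
      using \<theta> x by (simp add: ratio_nonneg flip: ennreal_mult'')
  qed
  also have "\<dots> = 1" using nn_integral_post[of \<pi>0 x] reg x pi0_nonneg by (auto simp: regular_def)
  finally show ?thesis .
qed

lemma nn_integral_avg_ratio:
  assumes x[measurable]: "x \<in> space MX" and reg: "regular x"
  shows "(\<integral>\<^sup>+th. ennreal (post_prod x th) * ennreal (avg_ratio x th) \<partial>TB) = 1"
proof -
  interpret D: prob_space "density MT (\<lambda>\<theta>. ennreal (post MT f \<pi> x \<theta>))"
    by (rule prob_space_post[OF x reg])
  show ?thesis
    using D.nn_integral_PiM_average[of "ratio x" B] nn_integral_ratio[OF x reg] x B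
      nn_integral_TB_post_prod[OF x reg, of "\<lambda>th. ennreal (avg_ratio x th)"]
    by (simp add: ratio_nonneg avg_ratio_def[abs_def])
qed

text \<open>The averaging bound for the \<pi>-posterior: the second moment of \<open>ratio x\<close>
  minus 1 under that posterior is the chi-square divergence.\<close>

lemma post_prod_le_chi2:
  assumes x[measurable]: "x \<in> space MX" and reg: "regular x"
    and u[measurable]: "u \<in> borel_measurable TB" and u1: "\<And>th. th \<in> space TB \<Longrightarrow> u th \<le> 1"
  shows "(\<integral>\<^sup>+th. ennreal (post_prod x th) * u th \<partial>TB)
    \<le> (\<integral>\<^sup>+th. ennreal (post_prod x th) * (ennreal (avg_ratio x th) * u th) \<partial>TB)
      + sqrt_enn (chi2 MT (post MT f \<pi>0 x) (post MT f \<pi> x)) / ennreal (2 * sqrt B)"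
proof -
  let ?D = "density MT (\<lambda>\<theta>. ennreal (post MT f \<pi> x \<theta>))"
  interpret D: prob_space ?D by (rule prob_space_post[OF x reg])
  have sets: "sets (PiM {..<B} (\<lambda>_. ?D)) = sets TB" by (intro sets_PiM_cong) auto
  have chi: "(\<integral>\<^sup>+\<theta>. ennreal ((ratio x \<theta> - 1)\<^sup>2) \<partial>?D) = chi2 MT (post MT f \<pi>0 x) (post MT f \<pi> x)"
    unfolding chi2_def ratio_def
    by (subst nn_integral_density)
       (auto intro!: nn_integral_cong simp: ennreal_mult'' post_nonneg less_imp_le[OF pi_pos] x mult.commute)
  have "(\<integral>\<^sup>+th. u th \<partial>PiM {..<B} (\<lambda>_. ?D))
     \<le> (\<integral>\<^sup>+th. ennreal ((\<Sum>b<B. ratio x (th b)) / B) * u th \<partial>PiM {..<B} (\<lambda>_. ?D))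
       + sqrt_enn (\<integral>\<^sup>+\<theta>. ennreal ((ratio x \<theta> - 1)\<^sup>2) \<partial>?D) / ennreal (2 * sqrt B)"
  proof (rule D.nn_integral_PiM_average_le[OF _ _ nn_integral_ratio[OF x reg] B])
    show "u \<in> borel_measurable (PiM {..<B} (\<lambda>_. ?D))"
      using u sets by (simp cong: measurable_cong_sets)
    show "u th \<le> 1" if "th \<in> space (PiM {..<B} (\<lambda>_. ?D))" for th
      using that u1 sets_eq_imp_space_eq[OF sets] by simp
  qed (auto simp: ratio_nonneg x)
  then show ?thesis
    unfolding chi avg_ratio_def[symmetric] by (simp add: nn_integral_TB_post_prod[OF x reg])
qed

text \<open>Both marginals integrate to 1, hence are finite almost everywhere; the two support
  conditions make both positive as soon as one likelihood is positive at \<open>x\<close>.\<close>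

lemma AE_regular_or_null:
  "AE x in MX. regular x \<or> (\<forall>\<theta>\<in>space MT. f \<theta> x = 0)"
proof -
  have fin: "AE x in MX. margE MT f \<rho> x \<noteq> \<infinity>"
    if "\<rho> \<in> borel_measurable MT" "\<And>\<theta>. \<theta> \<in> space MT \<Longrightarrow> 0 \<le> \<rho> \<theta>" "(\<integral>\<^sup>+\<theta>. ennreal (\<rho> \<theta>) \<partial>MT) = 1" for \<rho>
    using that nn_integral_margE[of \<rho>] by (intro nn_integral_PInf_AE) auto
  have "AE x in MX. margE MT f \<pi> x \<noteq> \<infinity>"
    by (rule fin) (auto simp: pi_dens less_imp_le[OF pi_pos])
  moreover have "AE x in MX. margE MT f \<pi>0 x \<noteq> \<infinity>"
    by (rule fin) (auto simp: pi0_dens pi0_nonneg)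
  ultimately show ?thesis using AE_space
  proof eventually_elim
    case (elim x)
    show ?case
    proof (cases "\<exists>\<theta>\<in>space MT. 0 < f \<theta> x")
      case True
      then show ?thesis using elim supp supp0 by (auto simp: regular_def less_top)
    next
      case False
      then show ?thesis using elim(3) f_nonneg by (force simp: not_less intro: antisym)
    qed
  qed
qed

section \<open>The tilted joint density of parameters and observation\<close>

lemma weight_gu_eq_ennreal:
  assumes x: "x \<in> space MX" and reg: "regular x" and th: "th \<in> space TB"
  shows "ennreal (weight th) * ennreal (gu th x)
    = ennreal (marg MT f \<pi>0 x) * (ennreal (post_prod x th) * ennreal (avg_ratio x th))"
proof -
  have m: "0 \<le> marg MT f \<pi>0 x" by (simp add: marg_def)
  have "ennreal (weight th) * ennreal (gu th x) = ennreal (weight th * gu th x)"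
    using th by (simp add: ennreal_mult' weight_nonneg)
  also have "\<dots> = ennreal (marg MT f \<pi>0 x * (post_prod x th * avg_ratio x th))"
    by (simp only: weight_gu_eq[OF x reg th])
  also have "\<dots> = ennreal (marg MT f \<pi>0 x) * (ennreal (post_prod x th) * ennreal (avg_ratio x th))"
    using m post_prod_nonneg[OF th x] by (simp only: ennreal_mult')
  finally show ?thesis .
qed

text \<open>At a regular \<open>x\<close> the tilted posterior integrates to 1, so only the marginal
  of \<pi>0 remains. At almost every other \<open>x\<close> all likelihoods vanish and both sides
  are 0.\<close>

lemma AE_nn_integral_weight_gu:
  "AE x in MX. (\<integral>\<^sup>+th. ennreal (weight th) * ennreal (gu th x) \<partial>TB) = margE MT f \<pi>0 x"
  using AE_regular_or_null AE_space
proof eventually_elim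
  case (elim x)
  note elim(2)[measurable]
  show ?case
  proof (cases "regular x")
    case True
    have "(\<integral>\<^sup>+th. ennreal (weight th) * ennreal (gu th x) \<partial>TB)
      = (\<integral>\<^sup>+th. ennreal (marg MT f \<pi>0 x) * (ennreal (post_prod x th) * ennreal (avg_ratio x th)) \<partial>TB)"
      using weight_gu_eq_ennreal[OF elim(2) True] by (simp cong: nn_integral_cong)
    also have "\<dots> = ennreal (marg MT f \<pi>0 x)"
      by (subst nn_integral_cmult) (measurable, simp add: nn_integral_avg_ratio[OF elim(2) True])
    also have "\<dots> = margE MT f \<pi>0 x" using True by (simp add: regular_def marg_def)
    finally show ?thesis .
  next
    case False
    then have z: "f \<theta> x = 0" if "\<theta> \<in> space MT" for \<theta> using elim(1) that by auto
    have "gu th x = 0" if "th \<in> space TB" for th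
      \<comment> \<open>As B is at least 1, the product in \<open>gu\<close> contains the factor
        with index 0, which vanishes.\<close>
      using B z[OF space_TB[OF that, of 0]] by (auto simp: g_un_def intro!: bexI[of _ 0])
    then show ?thesis by (simp add: margE_def z cong: nn_integral_cong)
  qed
qed

text \<open>The parameter marginal of the tilted joint density has mass 1, because by Fubini it has
  the same mass as the observation marginal.\<close>

lemma nn_integral_weight_gn: "(\<integral>\<^sup>+th. ennreal (weight th) * gn th \<partial>TB) = 1"
proof -
  have "(\<integral>\<^sup>+th. ennreal (weight th) * gn th \<partial>TB)
      = (\<integral>\<^sup>+th. \<integral>\<^sup>+x. ennreal (weight th) * ennreal (gu th x) \<partial>MX \<partial>TB)"
    unfolding g_norm_def by (intro nn_integral_cong, subst nn_integral_cmult) auto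
  also have "\<dots> = (\<integral>\<^sup>+x. \<integral>\<^sup>+th. ennreal (weight th) * ennreal (gu th x) \<partial>TB \<partial>MX)"
    by (rule XTB.Fubini') measurable
  also have "\<dots> = (\<integral>\<^sup>+x. margE MT f \<pi>0 x \<partial>MX)"
    by (rule nn_integral_cong_AE[OF AE_nn_integral_weight_gu])
  also have "\<dots> = 1" by (simp add: nn_integral_margE pi0_nonneg pi0_dens)
  finally show ?thesis .
qed

text \<open>A finite total integral forces the integrand to be finite almost everywhere, so an
  infinite normaliser can only meet weight 0.\<close>

lemma AE_weight_gn: "AE th in TB. weight th = 0 \<or> gn th < \<infinity>"
proof -
  have "AE th in TB. ennreal (weight th) * gn th \<noteq> \<infinity>"
    by (rule nn_integral_PInf_AE) (auto simp: nn_integral_weight_gn)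
  then show ?thesis using AE_space
  proof eventually_elim
    case (elim th)
    then show ?case using weight_nonneg[of th] by (auto simp: ennreal_mult_eq_top_iff less_top)
  qed
qed

text \<open>With \<open>th\<close> of density \<open>weight th * gn th\<close>, all \<open>M + 1\<close> observations are conditionally
  i.i.d. from \<open>gd th\<close>, each with marginal density \<open>margE MT f \<pi>0\<close>.\<close>
definition exch_law :: "nat \<Rightarrow> (nat \<Rightarrow> 'a) measure" where
  "exch_law M = density (PiM {..M} (\<lambda>_. MX))
     (\<lambda>z. \<integral>\<^sup>+th. ennreal (weight th) * gn th * (\<Prod>m\<in>{..M}. ennreal (gd th (z m))) \<partial>TB)"

section \<open>Mass and symmetry of the comparison law\<close>

lemma sets_exch_law: "sets (exch_law M) = sets (PiM {..M} (\<lambda>_. MX))"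
  by (simp add: exch_law_def)

lemma emeasure_exch_law:
  assumes A: "A \<in> sets (PiM {..M} (\<lambda>_. MX))"
  shows "emeasure (exch_law M) A
    = (\<integral>\<^sup>+th. \<integral>\<^sup>+x. ennreal (weight th) * gn th * ennreal (gd th x) * resample M A x th \<partial>MX \<partial>TB)"
proof -
  note A[measurable]
  have "(\<Prod>m\<in>{..M}. ennreal (gd th (z m))) = ennreal (gd th (z 0)) * (\<Prod>m\<in>{1..M}. ennreal (gd th (z m)))" for th z
    unfolding atMost_eq_insert_0 by simp
  then have "exch_law M = density (PiM {..M} (\<lambda>_. MX)) (\<lambda>z. \<integral>\<^sup>+th. ennreal (weight th) * gn th *
      ennreal (gd th (z 0)) * (\<Prod>m\<in>{1..M}. ennreal (gd th (z m))) \<partial>TB)"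
    unfolding exch_law_def by (simp only: mult.assoc)
  then have "emeasure (exch_law M) A
    = (\<integral>\<^sup>+x. \<integral>\<^sup>+th. ennreal (weight th) * gn th * ennreal (gd th x) * resample M A x th \<partial>TB \<partial>MX)"
    by (simp only:) (rule emeasure_density_resample[OF _ A], measurable)
  also have "\<dots> = (\<integral>\<^sup>+th. \<integral>\<^sup>+x. ennreal (weight th) * gn th * ennreal (gd th x) * resample M A x th \<partial>MX \<partial>TB)"
    by (rule XTB.Fubini'[symmetric]) measurable
  finally show ?thesis .
qed

lemma prob_space_exch_law: "prob_space (exch_law M)"
proof
  let ?S = "space (PiM {..M} (\<lambda>_. MX))"
  have sp: "space (exch_law M) = ?S" by (simp add: exch_law_def)
  have "emeasure (exch_law M) ?S
    = (\<integral>\<^sup>+th. \<integral>\<^sup>+x. ennreal (weight th) * gn th * ennreal (gd th x) * resample M ?S x th \<partial>MX \<partial>TB)"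
    by (rule emeasure_exch_law) simp
  also have "\<dots> = (\<integral>\<^sup>+th. ennreal (weight th) * gn th \<partial>TB)"
  proof (rule nn_integral_cong_AE, use AE_weight_gn AE_space in eventually_elim)
    case (elim th)
    note elim(2)[measurable]
    show ?case
    proof (cases "0 < gn th \<and> gn th < \<infinity>")
      case True
      then have "(\<integral>\<^sup>+x. ennreal (weight th) * gn th * ennreal (gd th x) * resample M ?S x th \<partial>MX)
        = (\<integral>\<^sup>+x. ennreal (weight th) * gn th * ennreal (gd th x) \<partial>MX)"
        using elim by (intro nn_integral_cong) (simp add: resample_space)
      also have "\<dots> = ennreal (weight th) * gn th"
        using True elim by (subst nn_integral_cmult) (auto simp: nn_integral_gd)
      finally show ?thesis .
    next
      \<comment> \<open>Here \<open>gn th\<close> is 0, or it is infinite and the weight is 0;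
        either way such \<open>th\<close> carries no mass.\<close>
      case False
      then have "ennreal (weight th) * gn th = 0" using elim(1) by auto
      then show ?thesis by auto
    qed
  qed
  also have "\<dots> = 1" by (rule nn_integral_weight_gn)
  finally show "emeasure (exch_law M) (space (exch_law M)) = 1" by (simp add: sp)
qed

lemma exchangeable_exch_law: "exchangeable_law MX M (exch_law M)"
  unfolding exchangeable_law_def
proof (intro conjI allI impI)
  show "prob_space (exch_law M)" by (rule prob_space_exch_law)
  show "sets (exch_law M) = sets (PiM {..M} (\<lambda>_. MX))" by (rule sets_exch_law)
  fix \<sigma> assume \<sigma>: "\<sigma> permutes {..M}"
  show "distr (exch_law M) (PiM {..M} (\<lambda>_. MX)) (\<lambda>z. restrict (z \<circ> \<sigma>) {..M}) = exch_law M"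
    unfolding exch_law_def
  proof (rule distr_density_PiM_permute[OF MX.sigma_finite_measure_axioms _ \<sigma>])
    have [measurable]: "(\<lambda>p. \<Prod>m\<in>{..M}. ennreal (gd (snd p) (fst p m)))
        \<in> borel_measurable (PiM {..M} (\<lambda>_. MX) \<Otimes>\<^sub>M TB)"
      by (rule measurable_prod_gd[where I = "{..M}"]) auto
    show "(\<lambda>z. \<integral>\<^sup>+th. ennreal (weight th) * gn th * (\<Prod>m\<in>{..M}. ennreal (gd th (z m))) \<partial>TB)
        \<in> borel_measurable (PiM {..M} (\<lambda>_. MX))"
      by (intro TB.borel_measurable_nn_integral) (simp add: split_beta')
    fix z :: "nat \<Rightarrow> 'a"
    \<comment> \<open>Given \<open>th\<close>, all coordinates including 0 have the same factor, so
      a permutation only reorders the product.\<close>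
    have "(\<Prod>m\<in>{..M}. ennreal (gd th (restrict (z \<circ> \<sigma>) {..M} m))) = (\<Prod>m\<in>{..M}. ennreal (gd th (z m)))" for th
      using prod.permute[OF \<sigma>, of "\<lambda>m. ennreal (gd th (z m))"] by (simp add: comp_def)
    then show "(\<integral>\<^sup>+th. ennreal (weight th) * gn th * (\<Prod>m\<in>{..M}. ennreal (gd th (restrict (z \<circ> \<sigma>) {..M} m))) \<partial>TB)
        = (\<integral>\<^sup>+th. ennreal (weight th) * gn th * (\<Prod>m\<in>{..M}. ennreal (gd th (z m))) \<partial>TB)"
      by simp
  qed simp
qed

text \<open>Returns from the form in which the tilted observation is drawn jointly with
  \<open>th\<close> to the form in which it is drawn from \<open>gd th\<close>. For positive finite
  \<open>gn th\<close> this is \<open>gu = gn * gd\<close>; for \<open>gn th = 0\<close> the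
  function \<open>gu th\<close> vanishes almost everywhere; an infinite normaliser has weight 0
  almost everywhere.\<close>

lemma nn_integral_weight_gu_le_exch_law:
  assumes A[measurable]: "A \<in> sets (PiM {..M} (\<lambda>_. MX))"
  shows "(\<integral>\<^sup>+x. \<integral>\<^sup>+th. ennreal (weight th) * ennreal (gu th x) * resample M A x th \<partial>TB \<partial>MX)
    \<le> emeasure (exch_law M) A"
proof -
  have "(\<integral>\<^sup>+x. \<integral>\<^sup>+th. ennreal (weight th) * ennreal (gu th x) * resample M A x th \<partial>TB \<partial>MX)
    = (\<integral>\<^sup>+th. \<integral>\<^sup>+x. ennreal (weight th) * ennreal (gu th x) * resample M A x th \<partial>MX \<partial>TB)"
    by (rule XTB.Fubini'[symmetric]) measurable
  also have "\<dots> \<le> (\<integral>\<^sup>+th. \<integral>\<^sup>+x. ennreal (weight th) * gn th * ennreal (gd th x) * resample M A x th \<partial>MX \<partial>TB)"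
  proof (rule nn_integral_mono_AE, use AE_weight_gn AE_space in eventually_elim)
    case (elim th)
    note elim(2)[measurable]
    show ?case
    proof (rule nn_integral_mono_AE)
      consider "weight th = 0" | "gn th = 0" | "0 < gn th" "gn th < \<infinity>"
        using elim(1) by (auto simp: zero_less_iff_neq_zero)
      then show "AE x in MX. ennreal (weight th) * ennreal (gu th x) * resample M A x th
          \<le> ennreal (weight th) * gn th * ennreal (gd th x) * resample M A x th"
      proof cases
        case 1 then show ?thesis by simp
      next
        case 2
        then have "AE x in MX. ennreal (gu th x) = 0"
          unfolding g_norm_def by (subst (asm) nn_integral_0_iff_AE) auto
        then show ?thesis by eventually_elim simp
      next
        case 3
        then have g: "0 < enn2real (gn th)" "ennreal (enn2real (gn th)) = gn th"
          by (auto simp: enn2real_positive_iff)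
        have "ennreal (gu th x) = gn th * ennreal (gd th x)" if "x \<in> space MX" for x
        proof -
          have "gu th x = enn2real (gn th) * gd th x" using g by (simp add: g_dens_def)
          then have "ennreal (gu th x) = ennreal (enn2real (gn th)) * ennreal (gd th x)"
            using g(1) by (simp add: ennreal_mult')
          then show ?thesis by (simp only: g(2))
        qed
        then show ?thesis by (intro AE_I2) (simp add: mult.assoc)
      qed
    qed
  qed
  also have "\<dots> = emeasure (exch_law M) A" by (rule emeasure_exch_law[OF A, symmetric])
  finally show ?thesis .
qed

section \<open>Comparison of the joint law with the exchangeable law\<close>

lemma nn_integral_post_prod:
  assumes x[measurable]: "x \<in> space MX" and reg: "regular x"
  shows "(\<integral>\<^sup>+th. ennreal (post_prod x th) \<partial>TB) = 1"
proof -
  interpret D: prob_space "PiM {..<B} (\<lambda>_. density MT (\<lambda>\<theta>. ennreal (post MT f \<pi> x \<theta>)))"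
    by (intro prob_space_PiM prob_space_post[OF x reg])
  show ?thesis
    using nn_integral_TB_post_prod[OF x reg, of "\<lambda>_. 1"] D.emeasure_space_1 by simp
qed

lemma prob_space_joint_law:
  assumes \<theta>0: "\<theta>0 \<in> space MT"
    and g_wd: "AE x in MX. 0 < f \<theta>0 x \<longrightarrow>
       (AE th in TB. 0 < post_prod x th \<longrightarrow> 0 < gn th \<and> gn th < \<infinity>)"
  shows "prob_space (joint_law MX MT f \<pi> \<theta>0 B M)"
proof
  let ?S = "space (PiM {..M} (\<lambda>_. MX))"
  have sp: "space (joint_law MX MT f \<pi> \<theta>0 B M) = ?S" by (simp add: joint_law_def)
  have "emeasure (joint_law MX MT f \<pi> \<theta>0 B M) ?S
    = (\<integral>\<^sup>+x. ennreal (f \<theta>0 x) * (\<integral>\<^sup>+th. ennreal (post_prod x th) * resample M ?S x th \<partial>TB) \<partial>MX)"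
    by (rule emeasure_joint_law[OF \<theta>0]) simp
  also have "\<dots> = (\<integral>\<^sup>+x. ennreal (f \<theta>0 x) \<partial>MX)"
  proof (rule nn_integral_cong_AE, use AE_regular_or_null g_wd AE_space in eventually_elim)
    case (elim x)
    show ?case
    proof (cases "0 < f \<theta>0 x")
      case True
      then have reg: "regular x" using elim(1) \<theta>0 by auto
      have "AE th in TB. 0 < post_prod x th \<longrightarrow> 0 < gn th \<and> gn th < \<infinity>"
        using True elim(2) by simp
      \<comment> \<open>By \<open>g_wd\<close>, almost every \<open>th\<close> charged by the
        posterior product is normalisable, so its resampling kernel has full mass.\<close>
      then have "AE th in TB. ennreal (post_prod x th) * resample M ?S x th = ennreal (post_prod x th)"
        using AE_space
      proof eventually_elim
        case (elim th)
        show ?case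
        proof (cases "0 < post_prod x th")
          case True
          then show ?thesis using elim \<open>x \<in> space MX\<close> by (simp add: resample_space)
        next
          case False
          then have "ennreal (post_prod x th) = 0" by (simp add: ennreal_neg not_less)
          then show ?thesis by (simp only: mult_zero_left)
        qed
      qed
      then have "(\<integral>\<^sup>+th. ennreal (post_prod x th) * resample M ?S x th \<partial>TB) = 1"
        using nn_integral_post_prod[OF elim(3) reg] by (simp cong: nn_integral_cong_AE)
      then show ?thesis by simp
    next
      case False
      then have "ennreal (f \<theta>0 x) = 0" by (simp add: ennreal_neg not_less)
      then show ?thesis by simp
    qed
  qed
  also have "\<dots> = 1" by (rule f_dens[OF \<theta>0])
  finally show "emeasure (joint_law MX MT f \<pi> \<theta>0 B M) (space (joint_law MX MT f \<pi> \<theta>0 B M)) = 1"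
    by (simp add: sp)
qed

text \<open>Two replacements: first the posterior product by its tilted version at fixed
  \<open>x\<close>, then the density of the first observation by the marginal of \<pi>0. What
  remains is the tilted joint law.\<close>

lemma emeasure_joint_law_le:
  assumes \<theta>0: "\<theta>0 \<in> space MT" and A[measurable]: "A \<in> sets (PiM {..M} (\<lambda>_. MX))"
  shows "emeasure (joint_law MX MT f \<pi> \<theta>0 B M) A \<le> emeasure (exch_law M) A
    + (ennreal (eps_err MX MT f \<theta>0 \<pi>0) + Delta_err MX MT f \<pi> \<theta>0 \<pi>0 / ennreal (2 * sqrt B))"
proof -
  note \<theta>0[measurable]
  define p where "p x = ennreal (f \<theta>0 x)" for x
  define \<delta> where "\<delta> x = sqrt_enn (chi2 MT (post MT f \<pi>0 x) (post MT f \<pi> x))" for x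
  \<comment> \<open>At regular \<open>x\<close>, the conditional probability of \<open>A\<close>
    given first observation \<open>x\<close> under the tilted law. The value 0 elsewhere gives the
    bound by 1 at every point, as the total variation bound for test functions requires.\<close>
  define k where "k x = (if regular x
     then \<integral>\<^sup>+th. ennreal (post_prod x th) * (ennreal (avg_ratio x th) * resample M A x th) \<partial>TB else 0)" for x
  have [measurable]: "p \<in> borel_measurable MX" unfolding p_def by measurable
  have [measurable]: "k \<in> borel_measurable MX" unfolding k_def by measurable
  have [measurable]: "\<delta> \<in> borel_measurable MX" unfolding \<delta>_def chi2_def by measurable
  have k1: "k x \<le> 1" if x: "x \<in> space MX" for x
  proof (cases "regular x")
    case True
    have "k x \<le> (\<integral>\<^sup>+th. ennreal (post_prod x th) * ennreal (avg_ratio x th) \<partial>TB)"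
      unfolding k_def using True
      by (auto intro!: nn_integral_mono mult_left_mono mult_left_le resample_le_1)
    then show ?thesis using nn_integral_avg_ratio[OF x True] by simp
  qed (simp add: k_def)
  have "emeasure (joint_law MX MT f \<pi> \<theta>0 B M) A
    = (\<integral>\<^sup>+x. p x * (\<integral>\<^sup>+th. ennreal (post_prod x th) * resample M A x th \<partial>TB) \<partial>MX)"
    unfolding p_def by (rule emeasure_joint_law[OF \<theta>0 A])
  \<comment> \<open>Cost of tilting the posterior. At almost every irregular \<open>x\<close> the
    density of \<theta>0 is 0.\<close>
  also have "\<dots> \<le> (\<integral>\<^sup>+x. p x * k x + p x * \<delta> x / ennreal (2 * sqrt B) \<partial>MX)"
  proof (rule nn_integral_mono_AE, use AE_regular_or_null AE_space in eventually_elim)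
    case (elim x)
    note elim(2)[measurable]
    show ?case
    proof (cases "regular x")
      case True
      have "(\<integral>\<^sup>+th. ennreal (post_prod x th) * resample M A x th \<partial>TB) \<le> k x + \<delta> x / ennreal (2 * sqrt B)"
        using post_prod_le_chi2[OF elim(2) True, of "resample M A x"] True
        by (simp add: k_def \<delta>_def resample_le_1)
      from mult_left_mono[OF this, of "p x"] show ?thesis
        by (simp add: distrib_left ennreal_times_divide)
    next
      case False
      then show ?thesis using elim \<theta>0 by (simp add: p_def)
    qed
  qed
  also have "\<dots> = (\<integral>\<^sup>+x. p x * k x \<partial>MX) + Delta_err MX MT f \<pi> \<theta>0 \<pi>0 / ennreal (2 * sqrt B)"
    unfolding Delta_err_def p_def[symmetric] \<delta>_def[symmetric]
    by (simp add: nn_integral_add nn_integral_divide)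
  \<comment> \<open>Cost of replacing the density of the first observation, with \<open>k\<close> as
    test function.\<close>
  also have "(\<integral>\<^sup>+x. p x * k x \<partial>MX) \<le> (\<integral>\<^sup>+x. margE MT f \<pi>0 x * k x \<partial>MX) + ennreal (eps_err MX MT f \<theta>0 \<pi>0)"
    unfolding eps_err_def p_def[symmetric]
    by (rule nn_integral_le_tv_dist)
       (auto simp: k1 nn_integral_margE pi0_nonneg pi0_dens p_def f_dens \<theta>0)
  \<comment> \<open>The factorisation is read backwards: marginal times tilted posterior becomes
    \<open>weight\<close> times \<open>gu\<close>.\<close>
  also have "(\<integral>\<^sup>+x. margE MT f \<pi>0 x * k x \<partial>MX)
     \<le> (\<integral>\<^sup>+x. \<integral>\<^sup>+th. ennreal (weight th) * ennreal (gu th x) * resample M A x th \<partial>TB \<partial>MX)"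
  proof (rule nn_integral_mono)
    fix x assume x[measurable]: "x \<in> space MX"
    show "margE MT f \<pi>0 x * k x
      \<le> (\<integral>\<^sup>+th. ennreal (weight th) * ennreal (gu th x) * resample M A x th \<partial>TB)"
    proof (cases "regular x")
      case True
      then have H: "margE MT f \<pi>0 x = ennreal (marg MT f \<pi>0 x)" by (simp add: regular_def marg_def)
      have "margE MT f \<pi>0 x * k x = (\<integral>\<^sup>+th. ennreal (marg MT f \<pi>0 x) *
          (ennreal (post_prod x th) * (ennreal (avg_ratio x th) * resample M A x th)) \<partial>TB)"
        unfolding k_def H using True by (subst nn_integral_cmult) auto
      also have "\<dots> = (\<integral>\<^sup>+th. ennreal (weight th) * ennreal (gu th x) * resample M A x th \<partial>TB)"
        by (intro nn_integral_cong) (simp add: weight_gu_eq_ennreal[OF x True] mult.assoc)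
      finally show ?thesis by simp
    qed (simp add: k_def)
  qed
  also note nn_integral_weight_gu_le_exch_law[OF A]
  finally show ?thesis by (simp add: add_ac)
qed

end

section \<open>Distance to exchangeability\<close>

text \<open>\<open>g_wd\<close> makes explicit what speaking of the density proportional to
  \<open>g_un\<close> presupposes: it is normalisable for almost all posterior draws. Elsewhere
  \<open>g_dens\<close> is 0 by default and the resampling step would lose mass. The bound is stated
  in \<open>ennreal\<close> since \<open>Delta_err\<close> may be infinite.\<close>

theorem theorem1:
  fixes MX :: "'x measure" and MT :: "'t measure"
    and f :: "'t \<Rightarrow> 'x \<Rightarrow> real" and \<pi> :: "'t \<Rightarrow> real"
    and \<theta>0 :: 't and B M :: nat
  assumes "sigma_finite_measure MX" and "sigma_finite_measure MT"
    and f_meas: "(\<lambda>(\<theta>, x). f \<theta> x) \<in> borel_measurable (MT \<Otimes>\<^sub>M MX)"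
    and f_nonneg: "\<forall>\<theta>\<in>space MT. \<forall>x\<in>space MX. 0 \<le> f \<theta> x"
    and f_dens: "\<forall>\<theta>\<in>space MT. (\<integral>\<^sup>+ x. ennreal (f \<theta> x) \<partial>MX) = 1"
    and pi_meas: "\<pi> \<in> borel_measurable MT"
    and pi_pos: "\<forall>\<theta>\<in>space MT. 0 < \<pi> \<theta>"
    and pi_dens: "(\<integral>\<^sup>+ \<theta>. ennreal (\<pi> \<theta>) \<partial>MT) = 1"
    and supp: "\<forall>\<theta>\<in>space MT. \<forall>x\<in>space MX. 0 < f \<theta> x \<longrightarrow> 0 < margE MT f \<pi> x"
    and "B \<ge> 1" and "M \<ge> 1"
    and \<theta>0: "\<theta>0 \<in> space MT"
    and g_wd: "AE x in MX. 0 < f \<theta>0 x \<longrightarrow>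
                 (AE th in PiM {..<B} (\<lambda>_. MT). 0 < (\<Prod>b<B. post MT f \<pi> x (th b)) \<longrightarrow>
                    0 < g_norm MX MT f \<pi> B th \<and> g_norm MX MT f \<pi> B th < \<infinity>)"
  shows "ennreal (d_exch MX M (joint_law MX MT f \<pi> \<theta>0 B M))
           \<le> (INF \<pi>0 \<in> {\<pi>0. admissible_prior MX MT f \<pi>0}.
                ennreal (eps_err MX MT f \<theta>0 \<pi>0)
                + Delta_err MX MT f \<pi> \<theta>0 \<pi>0 / ennreal (2 * sqrt (real B)))"
proof (rule INF_greatest)
  interpret MX: sigma_finite_measure MX by fact
  interpret MT: sigma_finite_measure MT by fact
  fix \<pi>0 assume "\<pi>0 \<in> {\<pi>0. admissible_prior MX MT f \<pi>0}"
  then interpret resampling_model_prior MX MT f \<pi> B \<pi>0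
    using assms by unfold_locales auto
  let ?P = "joint_law MX MT f \<pi> \<theta>0 B M"
  have P: "prob_space ?P"
    by (rule prob_space_joint_law[OF \<theta>0 g_wd])
  have "d_exch MX M ?P \<le> tv_dist ?P (exch_law M)"
    unfolding d_exch_def
  proof (rule cINF_lower)
    show "bdd_below (tv_dist ?P ` {Q. exchangeable_law MX M Q})"
      using P by (auto intro!: bdd_belowI[of _ 0] tv_dist_nonneg simp: exchangeable_law_def)
  qed (simp add: exchangeable_exch_law)
  then have "ennreal (d_exch MX M ?P) \<le> ennreal (tv_dist ?P (exch_law M))"
    by (rule ennreal_leI)
  also have "\<dots> \<le> ennreal (eps_err MX MT f \<theta>0 \<pi>0) + Delta_err MX MT f \<pi> \<theta>0 \<pi>0 / ennreal (2 * sqrt (real B))"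
    by (rule tv_dist_le[OF P prob_space_exch_law])
       (auto simp: sets_joint_law sets_exch_law intro: emeasure_joint_law_le[OF \<theta>0])
  finally show "ennreal (d_exch MX M ?P)
    \<le> ennreal (eps_err MX MT f \<theta>0 \<pi>0) + Delta_err MX MT f \<pi> \<theta>0 \<pi>0 / ennreal (2 * sqrt (real B))" .
qed

end
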